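(* Consider SPARKLE-GT ($A_s=W_s^2$, $B_s=I-W_s$, $C_s=W_s^2$ for all $s\in\{x,y,z\}$) or its variants with semi-ATC-GT ($A_s=W_s$, $B_s=I-W_s$, $C_s=W_s^2$) or non-ATC-GT ($A_s=I$, $B_s=I-W_s$, $C_s=W_s^2$), with $W_y=W_z$. Then (for a suitable choice of the factorizations defining $\mathbf O_s,\mathbf\Gamma_s$) $$\delta_x=\mathcal O\big((1-\rho(W_x))^{-2}\big),\qquad \delta_y=\delta_z=\mathcal O\big((1-\rho(W_y))^{-2}\big),$$ $$\hat\delta_x=\mathcal O\big((1-\rho(W_x))^{-2}\big),\qquad \hat\delta_y=\hat\delta_z=\mathcal O\big((1-\rho(W_y))^{-8/3}\big).$$ Furthermore, if $W_x=W_y=W_z$ and $\rho=\rho(W_x)$, then the transient iteration complexity $\max\{n^2\delta_x,n^3\delta_y,n^3\delta_z,n\hat\delta_x,n\hat\delta_y,n\hat\delta_z\}$ of the algorithm simplifies to order $\max\{n^3/(1-\rho)^2,\;n/(1-\rho)^{8/3}\}$.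
   Context: **Problem.** Agents $i=1,\dots,n$ hold $f_i(x,y)=\mathbb E_{\phi\sim\mathcal D_{f_i}}[F_i(x,y;\phi)]$ and $g_i(x,y)=\mathbb E_{\xi\sim\mathcal D_{g_i}}[G_i(x,y;\xi)]$ on $\mathbb R^p\times\mathbb R^q$. Put $f=\frac1n\sum_if_i$, $g=\frac1n\sum_ig_i$, $y^\star(x)=\arg\min_yg(x,y)$, $\Phi(x)=f(x,y^\star(x))$; indices $1,2$ on $\nabla$ denote derivatives in the first/second argument. $\|\cdot\|$ is the Euclidean/spectral norm. **Assumptions.** (1) For every $i$: $\nabla f_i,\nabla g_i,\nabla^2g_i$ are Lipschitz with constants $L_{f,1},L_{g,1},L_{g,2}$; $\|\nabla_2f_i(x,y^\star(x))\|\le L_{f,0}$ for all $x$; $g_i(x,\cdot)$ is $\mu_g$-strongly convex for every $x$. (2) For $s\in\{x,y,z\}$, $W_s\in\mathbb R^{n\times n}$ is nonnegative, symmetric, doubly stochastic, with eigenvalues $1=\lambda_1>\lambda_2\ge\dots\ge\lambda_n$ and $\rho(W_s)=\max\{|\lambda_2|,|\lambda_n|\}<1$. (3) The stochastic estimates $\nabla F_i,\nabla G_i,\nabla^2G_i$ are unbiased for $\nabla f_i,\nabla g_i,\nabla^2g_i$ with variances bounded by $\sigma_{f,1}^2,\sigma_{g,1}^2,\sigma_{g,2}^2$. **SPARKLE algorithm.** Bold letters stack agents: $\mathbf x^k=\mathrm{col}\{x_1^k,\dots,x_n^k\}$, and $\mathbf A_s=A_s\otimes I$, $\mathbf B_s=B_s\otimes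 I$, $\mathbf C_s=C_s\otimes I$; $\bar x^k=\frac1n\sum_ix_i^k$. Start from $\mathbf x^0=\mathbf y^0=\mathbf z^0=\mathbf r^0=\mathbf 0$, $\mathbf d_x^0=\mathbf d_y^0=\mathbf d_z^0=\mathbf 0$; for $k=0,1,\dots$ $\mathbf y^{k+1}=\mathbf C_y\mathbf y^k-\beta\mathbf A_y\mathbf v^k-\mathbf B_y\mathbf d_y^k$, $\mathbf d_y^{k+1}=\mathbf d_y^k+\mathbf B_y\mathbf y^{k+1}$; $\mathbf z^{k+1}=\mathbf C_z\mathbf z^k-\gamma\mathbf A_z\mathbf p^k-\mathbf B_z\mathbf d_z^k$, $\mathbf d_z^{k+1}=\mathbf d_z^k+\mathbf B_z\mathbf z^{k+1}$; $\mathbf r^{k+1}=(1-\theta)\mathbf r^k+\theta\mathbf u^k$; $\mathbf x^{k+1}=\mathbf C_x\mathbf x^k-\alpha\mathbf A_x\mathbf r^{k+1}-\mathbf B_x\mathbf d_x^k$, $\mathbf d_x^{k+1}=\mathbf d_x^k+\mathbf B_x\mathbf x^{k+1}$. Here $v_i^k=\nabla_2G_i(x_i^k,y_i^k;\cdot)$; $p_i^k=H_i^kz_i^k-b_i^k$ with $H_i^k=\nabla^2_{22}G_i(x_i^k,y_i^{k+1};\cdot)$, $b_i^k=\nabla_2F_i(x_i^k,y_i^{k+1};\cdot)$; $u_i^k=l_i^k-J_i^kz_i^{k+1}$ with $l_i^k=\nabla_1F_i(x_i^k,y_i^{k+1};\cdot)$, $J_i^k=\nabla^2_{12}G_i(x_i^k,y_i^{k+1};\cdot)$.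 The samples are independent across agents and, conditionally on the history available before each of $\mathbf v^k,\mathbf p^k,\mathbf u^k$ is formed, the estimates are unbiased with variances bounded by $\sigma_{f,1}^2$ (for $\nabla F_i$), $\sigma_{g,1}^2$ (for $\nabla G_i$) and $\sigma_{g,2}^2$ (for $\nabla^2G_i$). **Matrix quantities.** Write $W_s=U_s\,\mathrm{diag}(1,\Lambda_s)U_s^\top$, $U_s=[\frac1{\sqrt n}\mathbf 1_n,\hat U_s]$ orthogonal. Then $A_s=U_s\mathrm{diag}(1,\Lambda_{sa})U_s^\top$, $B_s^2=U_s\mathrm{diag}(0,\Lambda_{sb}^2)U_s^\top$, $C_s=U_s\mathrm{diag}(1,\Lambda_{sc})U_s^\top$ with diagonal $\Lambda_{sa},\Lambda_{sb},\Lambda_{sc}$ of size $n-1$ and $\Lambda_{sb}$ positive definite; bold versions are $\otimes I$. Factor $\mathbf M_s=\begin{bmatrix}\mathbf\Lambda_{sc}-\mathbf\Lambda_{sb}^2&-\mathbf\Lambda_{sb}\\\mathbf\Lambda_{sb}&\mathbf I\end{bmatrix}=\mathbf O_s\mathbf\Gamma_s\mathbf O_s^{-1}$ with $\mathbf O_s$ invertible and $\|\mathbf\Gamma_s\|<1$ (same factorization for equal data). For $s\in\{y,z\}$, $$\delta_s=\Big(\tfrac{\|\mathbf O_s\|^2\|\mathbf O_s^{-1}\|^2}{1-\|\mathbf\Gamma_s\|}\Big)^2\|\mathbf\Lambda_{sa}\|^2,\quad \hat\delta_s=\Big(\tfrac{\|\mathbf O_s\|\|\mathbf O_s^{-1}\|\|\mathbf\Lambda_{sb}^{-1}\|}{1-\|\mathbf\Gamma_s\|}\Big)^{4/3},$$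 $$\delta_x=\Big(\tfrac{\|\mathbf O_x\|\|\mathbf O_x^{-1}\|}{1-\|\mathbf\Gamma_x\|}\|\mathbf\Lambda_{xa}\|\Big)^2,\quad \hat\delta_x=\Big(\tfrac{\|\mathbf O_x\|^2\|\mathbf O_x^{-1}\|^2\|\mathbf\Lambda_{xb}^{-1}\|^2}{1-\|\mathbf\Gamma_x\|}\Big)^{2/3}+\tfrac{\|\mathbf O_x\|\|\mathbf O_x^{-1}\|\|\mathbf\Lambda_{xb}^{-1}\|}{1-\|\mathbf\Gamma_x\|}.$$ **Transient iteration complexity.** The number of iterations $K$ (up to constants) after which, for suitable constant $\alpha,\beta,\gamma,\theta$, the guaranteed bound on $\frac1{K+1}\sum_{k\le K}\mathbb E\|\nabla\Phi(\bar x^k)\|^2$ is of the linear-speedup order $1/\sqrt{nK}$; dependence on the initialization, smoothness constants, $\kappa=\max\{L_{f,0},L_{f,1},L_{g,1},L_{g,2}\}/\mu_g$ and noise levels is suppressed. For SPARKLE it is of order $\max\{n^2\delta_x,n^3\delta_y,n^3\delta_z,n\hat\delta_x,n\hat\delta_y,n\hat\delta_z\}$.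
   Formalization: The O-constants depend on a lower bound c>0 for 1+λ_n(W_s), since bounds uniform over all W_s fail as λ_n→-1; in "order", the lower bound is for ρ≥r>0 with a constant depending on r and c, since it fails as ρ→0 when Λ_sa→0. *)

theory Defs
  imports
    Complex_Main
    "Jordan_Normal_Form.Gauss_Jordan_Elimination"
    "Jordan_Normal_Form.Char_Poly"
begin

section \<open>Norms, inverses, Kronecker products\<close>

definition euclidean_norm :: "real vec \<Rightarrow> real" where
  "euclidean_norm v = sqrt (v \<bullet> v)"

definition spectral_norm :: "real mat \<Rightarrow> real" where
  "spectral_norm A =
     (SUP v \<in> {v \<in> carrier_vec (dim_col A). euclidean_norm v \<le> 1}. euclidean_norm (A *\<^sub>v v))"

text \<open>Only meaningful for invertible square matrices.\<close>

abbreviation minv :: "real mat \<Rightarrow> real mat" where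
  "minv A \<equiv> the (mat_inverse A)"

definition kronecker :: "real mat \<Rightarrow> real mat \<Rightarrow> real mat" (infixl "\<otimes>\<^sub>K" 70) where
  "A \<otimes>\<^sub>K B = mat (dim_row A * dim_row B) (dim_col A * dim_col B)
     (\<lambda>(i, j). A $$ (i div dim_row B, j div dim_col B) * B $$ (i mod dim_row B, j mod dim_col B))"


section \<open>Mixing matrices\<close>

text \<open>The real eigenvalues with algebraic multiplicity, in decreasing order; the list is
  indexed from 0, so \<open>\<lambda>\<^sub>1, \<lambda>\<^sub>2, \<dots>, \<lambda>\<^sub>n\<close> are \<open>ls ! 0, ls ! 1, \<dots>, last ls\<close>.\<close>

definition eigenvalues_desc :: "real mat \<Rightarrow> real list" where
  "eigenvalues_desc W = rev (sorted_list_of_multiset (proots (char_poly W)))"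

definition lambda_min :: "real mat \<Rightarrow> real" where
  "lambda_min W = last (eigenvalues_desc W)"

definition mixing_rate :: "real mat \<Rightarrow> real" where
  "mixing_rate W = max \<bar>eigenvalues_desc W ! 1\<bar> \<bar>lambda_min W\<bar>"

definition mixing_matrix :: "nat \<Rightarrow> real mat \<Rightarrow> bool" where
  "mixing_matrix n W \<longleftrightarrow>
     W \<in> carrier_mat n n \<and> W\<^sup>T = W \<and>
     (\<forall>i<n. \<forall>j<n. 0 \<le> W $$ (i, j)) \<and>
     (\<forall>i<n. (\<Sum>j<n. W $$ (i, j)) = 1) \<and>
     (\<forall>j<n. (\<Sum>i<n. W $$ (i, j)) = 1) \<and>
     eigenvalues_desc W ! 0 = 1 \<and> eigenvalues_desc W ! 1 < 1 \<and>
     mixing_rate W < 1"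

definition block_diag1 :: "real \<Rightarrow> real mat \<Rightarrow> real mat" where
  "block_diag1 a D =
     four_block_mat (mat 1 1 (\<lambda>_. a)) (0\<^sub>m 1 (dim_col D)) (0\<^sub>m (dim_row D) 1) D"

definition eigenbasis :: "nat \<Rightarrow> real mat \<Rightarrow> real mat \<Rightarrow> bool" where
  "eigenbasis n W U \<longleftrightarrow>
     U \<in> carrier_mat n n \<and> U\<^sup>T * U = 1\<^sub>m n \<and>
     col U 0 = vec n (\<lambda>_. 1 / sqrt (real n)) \<and>
     W = U * block_diag1 1 (mat_diag (n - 1) (\<lambda>i. eigenvalues_desc W ! Suc i)) * U\<^sup>T"


section \<open>SPARKLE communication matrices\<close>

datatype variable = Var_x | Var_y | Var_z

text \<open>The upper-level variable lives in dimension \<open>p\<close>; the lower-level and the auxiliary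
  variable live in dimension \<open>q\<close>.\<close>

fun var_dim :: "nat \<Rightarrow> nat \<Rightarrow> variable \<Rightarrow> nat" where
  "var_dim p q Var_x = p"
| "var_dim p q Var_y = q"
| "var_dim p q Var_z = q"

datatype gt_variant = ATC_GT | Semi_ATC_GT | Non_ATC_GT

fun mat_A :: "gt_variant \<Rightarrow> real mat \<Rightarrow> real mat" where
  "mat_A ATC_GT W = W * W"
| "mat_A Semi_ATC_GT W = W"
| "mat_A Non_ATC_GT W = 1\<^sub>m (dim_row W)"

definition mat_B :: "real mat \<Rightarrow> real mat" where
  "mat_B W = 1\<^sub>m (dim_row W) - W"

definition mat_C :: "real mat \<Rightarrow> real mat" where
  "mat_C W = W * W"

definition spectral_data ::
  "nat \<Rightarrow> real mat \<Rightarrow> real mat \<Rightarrow> real mat \<Rightarrow> real mat \<Rightarrow> real mat \<Rightarrow> real mat \<Rightarrow> real mat \<Rightarrow> bool" where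
  "spectral_data n U A B C La Lb Lc \<longleftrightarrow>
     (\<forall>L \<in> {La, Lb, Lc}. L \<in> carrier_mat (n - 1) (n - 1) \<and> diagonal_mat L) \<and>
     (\<forall>i < n - 1. 0 < Lb $$ (i, i)) \<and>
     A = U * block_diag1 1 La * U\<^sup>T \<and>
     B * B = U * block_diag1 0 (Lb * Lb) * U\<^sup>T \<and>
     C = U * block_diag1 1 Lc * U\<^sup>T"

abbreviation bold :: "nat \<Rightarrow> real mat \<Rightarrow> real mat" where
  "bold d L \<equiv> L \<otimes>\<^sub>K 1\<^sub>m d"

text \<open>The arguments of the following notions are the bold matrices.\<close>

definition iteration_matrix :: "real mat \<Rightarrow> real mat \<Rightarrow> real mat" where
  "iteration_matrix Lb Lc = four_block_mat (Lc - Lb * Lb) (- Lb) Lb (1\<^sub>m (dim_row Lb))"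

definition factorization :: "real mat \<Rightarrow> real mat \<Rightarrow> real mat \<Rightarrow> bool" where
  "factorization M P \<Gamma> \<longleftrightarrow>
     P \<in> carrier_mat (dim_row M) (dim_row M) \<and> \<Gamma> \<in> carrier_mat (dim_row M) (dim_row M) \<and>
     invertible_mat P \<and> M = P * \<Gamma> * minv P \<and> spectral_norm \<Gamma> < 1"

fun delta :: "variable \<Rightarrow> real mat \<Rightarrow> real mat \<Rightarrow> real mat \<Rightarrow> real" where
  "delta Var_x P \<Gamma> La =
     (spectral_norm P * spectral_norm (minv P) / (1 - spectral_norm \<Gamma>) * spectral_norm La)\<^sup>2"
| "delta _ P \<Gamma> La =
     ((spectral_norm P)\<^sup>2 * (spectral_norm (minv P))\<^sup>2 / (1 - spectral_norm \<Gamma>))\<^sup>2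
       * (spectral_norm La)\<^sup>2"

fun delta_hat :: "variable \<Rightarrow> real mat \<Rightarrow> real mat \<Rightarrow> real mat \<Rightarrow> real" where
  "delta_hat Var_x P \<Gamma> Lb =
     ((spectral_norm P)\<^sup>2 * (spectral_norm (minv P))\<^sup>2 * (spectral_norm (minv Lb))\<^sup>2
        / (1 - spectral_norm \<Gamma>)) powr (2 / 3)
     + spectral_norm P * spectral_norm (minv P) * spectral_norm (minv Lb) / (1 - spectral_norm \<Gamma>)"
| "delta_hat _ P \<Gamma> Lb =
     (spectral_norm P * spectral_norm (minv P) * spectral_norm (minv Lb)
        / (1 - spectral_norm \<Gamma>)) powr (4 / 3)"

text \<open>Order of the transient iteration complexity of SPARKLE, as a function of the number of
  agents and of \<open>\<delta>\<^sub>s\<close> and \<open>\<delta>\<close>-hat\<open>\<^sub>s\<close>.\<close>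

definition transient_complexity :: "nat \<Rightarrow> (variable \<Rightarrow> real) \<Rightarrow> (variable \<Rightarrow> real) \<Rightarrow> real" where
  "transient_complexity n \<delta> \<delta>h =
     Max {real n ^ 2 * \<delta> Var_x, real n ^ 3 * \<delta> Var_y, real n ^ 3 * \<delta> Var_z,
          real n * \<delta>h Var_x, real n * \<delta>h Var_y, real n * \<delta>h Var_z}"

text \<open>
  A remark on uniformity.  For all three variants an eigenvalue \<open>\<lambda> \<noteq> 1\<close> of \<open>W\<close> contributes to the
  iteration matrix a two-dimensional block
  \<open>[[2\<lambda> - 1, -(1 - \<lambda>)], [1 - \<lambda>, 1]] = \<lambda> I + (1 - \<lambda>) [[-1, -1], [1, 1]]\<close>, i.e. a Jordan block
  for \<open>\<lambda>\<close> with coupling \<open>2 (1 - \<lambda>)\<close>.  Writing \<open>P\<close>, \<open>\<Gamma>\<close> for the factors, every factorization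
  therefore has \<open>\<parallel>P\<parallel> \<parallel>P\<^sup>-\<^sup>1\<parallel> / (1 - \<parallel>\<Gamma>\<parallel>) \<ge> (1 - 2\<lambda>) / (1 + \<lambda>)\<^sup>2\<close> for \<open>-1 < \<lambda> < 0\<close>
  (norm of the inverse of \<open>I + M\<close>), which is of order \<open>(1 - \<rho>)\<^sup>-\<^sup>2\<close> when \<open>\<lambda> = -\<rho>\<close> tends to \<open>-1\<close>.
  So bounds in terms of \<open>1 - \<rho>\<close> alone cannot have constants that are uniform in the distance
  of \<^const>\<open>lambda_min\<close> from \<open>-1\<close>; the constants are uniform on each class
  \<open>c \<le> 1 + lambda_min W\<close> with \<open>c > 0\<close> (\<open>c = 1\<close>: positive semidefinite mixing matrices), and every
  mixing matrix belongs to one of these classes.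
\<close>

end

theory Submission
  imports Defs "HOL-Analysis.L2_Norm"
begin

text \<open>
  An eigenvalue \<open>\<mu> \<noteq> 1\<close> of \<open>W\<close> contributes to the iteration matrix the block
  \<open>\<mu> I + (1 - \<mu>) N\<close> with \<open>N = [[-1, -1], [1, 1]]\<close> nilpotent, whatever the variant.  The basis
  \<open>(1, -1), (\<epsilon>, \<epsilon>)\<close> therefore brings all blocks simultaneously to the triangular form
  \<open>[[\<mu>, -2 \<epsilon> (1 - \<mu>)], [0, \<mu>]]\<close>.  For \<open>c \<le> 1\<close> and \<open>\<epsilon> = c / 8\<close> the coupling is so small that
  \<open>\<rho> \<le> \<parallel>\<Gamma>\<parallel> \<le> (1 + \<rho>) / 2\<close>, while the condition number of the basis is a constant depending only
  on \<open>c\<close>.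
\<close>

subsection \<open>The spectral norm\<close>

text \<open>Two demands on \<epsilon> conflict: the condition number of the basis grows like
  1/\<epsilon>, while the coupling 2 \<epsilon> (1 - \<mu>) has to fit into half the gap 1 -
  |\<mu>|. Near \<mu> = 1 the coupling shrinks together with the gap, so a small constant \<epsilon>
  is enough. Near \<mu> = -1 the coupling approaches 4 \<epsilon> while the gap is only 1 + \<mu>;
  there the bound 1 + \<mu> \<ge> c is what helps, and \<epsilon> is taken proportional to c. The
  claim that the complexity has exactly the stated order also needs lower bounds. They start from an
  eigenvalue of modulus \<rho>: it stands on the diagonal of \<Gamma> and determines entries of the
  bold \<open>La\<close> and of the inverse of the bold \<open>Lb\<close>, and no entry of a matrix
  exceeds its spectral norm.\<close>

lemma euclidean_norm_L2_set: "euclidean_norm v = L2_set (\<lambda>i. v $ i) {0..<dim_vec v}"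
  by (simp add: euclidean_norm_def L2_set_def scalar_prod_def power2_eq_square)

lemma euclidean_norm_nonneg [simp]: "0 \<le> euclidean_norm v"
  by (simp add: euclidean_norm_L2_set)

lemma euclidean_norm_sq: "(euclidean_norm v)\<^sup>2 = v \<bullet> v"
  by (simp add: euclidean_norm_L2_set L2_set_def sum_nonneg)
    (simp add: scalar_prod_def power2_eq_square)

lemma abs_index_le_euclidean_norm:
  assumes "i < dim_vec v"
  shows "\<bar>v $ i\<bar> \<le> euclidean_norm v"
proof -
  have "\<bar>v $ i\<bar> = L2_set (\<lambda>i. v $ i) {i}" by simp
  also have "\<dots> \<le> euclidean_norm v"
    unfolding euclidean_norm_L2_set L2_set_def
    using assms by (intro real_sqrt_le_mono sum_mono2) auto
  finally show ?thesis .
qed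

lemma euclidean_norm_smult: "euclidean_norm (r \<cdot>\<^sub>v v) = \<bar>r\<bar> * euclidean_norm v"
proof -
  have "(r \<cdot>\<^sub>v v) \<bullet> (r \<cdot>\<^sub>v v) = r\<^sup>2 * (v \<bullet> v)"
    by (simp add: power2_eq_square)
  then show ?thesis by (simp add: euclidean_norm_def real_sqrt_mult)
qed

text \<open>A crude bound whose purpose is to make the set under the supremum in
  \<open>spectral_norm\<close> bounded above; without it the real \<open>SUP\<close> gives no usable
  upper bound.\<close>

lemma euclidean_norm_mult_mat_vec_le:
  fixes A :: "real mat"
  assumes "v \<in> carrier_vec (dim_col A)" and "euclidean_norm v \<le> 1"
  shows "euclidean_norm (A *\<^sub>v v) \<le> (\<Sum>i<dim_row A. \<Sum>j<dim_col A. \<bar>A $$ (i, j)\<bar>)"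
proof -
  have "\<bar>(A *\<^sub>v v) $ i\<bar> \<le> (\<Sum>j<dim_col A. \<bar>A $$ (i, j)\<bar>)" if i: "i < dim_row A" for i
  proof -
    have "\<bar>(A *\<^sub>v v) $ i\<bar> = \<bar>\<Sum>j<dim_col A. A $$ (i, j) * v $ j\<bar>"
      using i assms by (simp add: scalar_prod_def lessThan_atLeast0)
    also have "\<dots> \<le> (\<Sum>j<dim_col A. \<bar>A $$ (i, j)\<bar> * \<bar>v $ j\<bar>)"
      by (rule order_trans[OF sum_abs]) (simp add: abs_mult)
    also have "\<dots> \<le> (\<Sum>j<dim_col A. \<bar>A $$ (i, j)\<bar> * 1)"
    proof (intro sum_mono mult_left_mono)
      fix j assume "j \<in> {..<dim_col A}"
      then show "\<bar>v $ j\<bar> \<le> 1"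
        using abs_index_le_euclidean_norm[of j v] assms by auto
    qed simp
    finally show ?thesis by simp
  qed
  then have "(\<Sum>i<dim_row A. \<bar>(A *\<^sub>v v) $ i\<bar>) \<le> (\<Sum>i<dim_row A. \<Sum>j<dim_col A. \<bar>A $$ (i, j)\<bar>)"
    by (intro sum_mono) auto
  moreover have "euclidean_norm (A *\<^sub>v v) \<le> (\<Sum>i<dim_row A. \<bar>(A *\<^sub>v v) $ i\<bar>)"
    unfolding euclidean_norm_L2_set using L2_set_le_sum_abs[of "\<lambda>i. (A *\<^sub>v v) $ i" "{0..<dim_row A}"]
    by (simp add: lessThan_atLeast0)
  ultimately show ?thesis by linarith
qed

lemma spectral_norm_upper_unit:
  assumes "v \<in> carrier_vec (dim_col A)" and "euclidean_norm v \<le> 1"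
  shows "euclidean_norm (A *\<^sub>v v) \<le> spectral_norm A"
  unfolding spectral_norm_def
  by (rule cSUP_upper) (use assms in \<open>auto intro!: bdd_aboveI2 euclidean_norm_mult_mat_vec_le\<close>)

lemma spectral_norm_upper:
  assumes v: "v \<in> carrier_vec (dim_col A)"
  shows "euclidean_norm (A *\<^sub>v v) \<le> spectral_norm A * euclidean_norm v"
proof (cases "euclidean_norm v = 0")
  case True
  have "v $ j = 0" if "j < dim_col A" for j
    using abs_index_le_euclidean_norm[of j v] that v True by auto
  then have "v = 0\<^sub>v (dim_col A)" using v by auto
  then have "A *\<^sub>v v = 0\<^sub>v (dim_row A)" by auto
  then show ?thesis using True by (simp add: euclidean_norm_def)
next
  case False
  define r where "r = 1 / euclidean_norm v"
  have pos: "0 < euclidean_norm v" using False euclidean_norm_nonneg[of v] by linarith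
  have "euclidean_norm (A *\<^sub>v (r \<cdot>\<^sub>v v)) \<le> spectral_norm A"
    using v pos by (intro spectral_norm_upper_unit) (auto simp: euclidean_norm_smult r_def)
  moreover have "A *\<^sub>v (r \<cdot>\<^sub>v v) = r \<cdot>\<^sub>v (A *\<^sub>v v)" using v by (intro mult_mat_vec) auto
  ultimately have "r * euclidean_norm (A *\<^sub>v v) \<le> spectral_norm A"
    using pos by (simp add: euclidean_norm_smult r_def)
  then show ?thesis using pos by (simp add: r_def field_simps)
qed

lemma spectral_norm_nonneg [simp]: "0 \<le> spectral_norm A"
proof -
  have "0 \<le> euclidean_norm (A *\<^sub>v 0\<^sub>v (dim_col A))" by simp
  also have "\<dots> \<le> spectral_norm A" by (rule spectral_norm_upper_unit) (auto simp: euclidean_norm_def)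
  finally show ?thesis .
qed

text \<open>Stated with squared norms, so that block computations reduce to inequalities between
  sums of squares and no root has to be handled.\<close>

lemma spectral_norm_leI:
  assumes "0 \<le> b"
    and "\<And>v. v \<in> carrier_vec (dim_col A) \<Longrightarrow> (A *\<^sub>v v) \<bullet> (A *\<^sub>v v) \<le> b\<^sup>2 * (v \<bullet> v)"
  shows "spectral_norm A \<le> b"
  unfolding spectral_norm_def
proof (rule cSUP_least)
  have "0\<^sub>v (dim_col A) \<in> {v \<in> carrier_vec (dim_col A). euclidean_norm v \<le> 1}"
    by (auto simp: euclidean_norm_def)
  then show "{v \<in> carrier_vec (dim_col A). euclidean_norm v \<le> 1} \<noteq> {}" by blast
next
  fix v assume v: "v \<in> {v \<in> carrier_vec (dim_col A). euclidean_norm v \<le> 1}"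
  have "(euclidean_norm (A *\<^sub>v v))\<^sup>2 \<le> (b * euclidean_norm v)\<^sup>2"
    using assms(2)[of v] v by (simp add: euclidean_norm_sq power_mult_distrib)
  then have "euclidean_norm (A *\<^sub>v v) \<le> b * euclidean_norm v"
    using assms(1) by (auto intro: power2_le_imp_le)
  also have "\<dots> \<le> b * 1" using v assms(1) by (intro mult_left_mono) auto
  finally show "euclidean_norm (A *\<^sub>v v) \<le> b" by simp
qed

text \<open>A unit vector as test vector extracts a column. This is the source of the lower bounds
  on the norms of \<Gamma>, of the bold \<open>La\<close> and of the inverse of the bold
  \<open>Lb\<close>.\<close>

lemma abs_index_le_spectral_norm:
  assumes "i < dim_row A" and "j < dim_col A"
  shows "\<bar>A $$ (i, j)\<bar> \<le> spectral_norm A"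
proof -
  let ?e = "unit_vec (dim_col A) j :: real vec"
  have "A *\<^sub>v ?e = col A j" using assms by (intro eq_vecI) auto
  then have "\<bar>A $$ (i, j)\<bar> = \<bar>(A *\<^sub>v ?e) $ i\<bar>" using assms by simp
  also have "\<dots> \<le> euclidean_norm (A *\<^sub>v ?e)"
    using assms by (intro abs_index_le_euclidean_norm) auto
  also have "\<dots> \<le> spectral_norm A"
    using assms by (intro spectral_norm_upper_unit) (auto simp: euclidean_norm_def)
  finally show ?thesis .
qed

text \<open>Submultiplicativity evaluated on one unit vector; a positive dimension guarantees that
  such a vector exists.\<close>

lemma one_le_spectral_norm_mult_inverse:
  assumes A: "A \<in> carrier_mat n n" and B: "B \<in> carrier_mat n n" and AB: "A * B = 1\<^sub>m n"
    and n: "0 < n"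
  shows "1 \<le> spectral_norm A * spectral_norm B"
proof -
  let ?e = "unit_vec n 0 :: real vec"
  have e: "euclidean_norm ?e = 1" using n by (simp add: euclidean_norm_def)
  have "1 = euclidean_norm ((A * B) *\<^sub>v ?e)" by (simp add: AB e)
  also have "(A * B) *\<^sub>v ?e = A *\<^sub>v (B *\<^sub>v ?e)" using A B by auto
  also have "euclidean_norm \<dots> \<le> spectral_norm A * euclidean_norm (B *\<^sub>v ?e)"
    using A B by (intro spectral_norm_upper) auto
  also have "\<dots> \<le> spectral_norm A * (spectral_norm B * euclidean_norm ?e)"
    using B by (intro mult_left_mono spectral_norm_upper) auto
  finally show ?thesis by (simp add: e)
qed

subsection \<open>Diagonal matrices and their inverses\<close>

lemma mat_diag_dims [simp]: "dim_row (mat_diag n f) = n" "dim_col (mat_diag n f) = n"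
  by (simp_all add: mat_diag_def)

lemma mat_diag_index [simp]:
  "i < n \<Longrightarrow> j < n \<Longrightarrow> mat_diag n f $$ (i, j) = (if i = j then f j else 0)"
  by (simp add: mat_diag_def)

lemma mat_diag_cong: "(\<And>i. i < n \<Longrightarrow> f i = g i) \<Longrightarrow> mat_diag n f = mat_diag n g"
  by (intro eq_matI) auto

lemma mat_diag_eq_iff: "mat_diag n f = mat_diag n g \<longleftrightarrow> (\<forall>i<n. f i = g i)"
  by (metis mat_diag_cong mat_diag_index)

lemma diagonal_mat_eq_mat_diag:
  assumes "L \<in> carrier_mat n n" and "diagonal_mat L"
  shows "L = mat_diag n (\<lambda>i. L $$ (i, i))"
  using assms by (intro eq_matI) (auto simp: diagonal_mat_def)

lemma mat_diag_add: "mat_diag n f + mat_diag n g = mat_diag n (\<lambda>i. f i + g i :: real)"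
  by (intro eq_matI) auto

lemma mat_diag_minus: "mat_diag n f - mat_diag n g = mat_diag n (\<lambda>i. f i - g i :: real)"
  by (intro eq_matI) auto

lemma mat_diag_uminus: "- mat_diag n f = mat_diag n (\<lambda>i. - f i :: real)"
  by (intro eq_matI) auto

lemma mat_diag_mult_vec:
  fixes f :: "nat \<Rightarrow> real"
  assumes "w \<in> carrier_vec n"
  shows "mat_diag n f *\<^sub>v w = vec n (\<lambda>i. f i * w $ i)"
proof (intro eq_vecI)
  fix i assume "i < dim_vec (vec n (\<lambda>i. f i * w $ i))"
  then show "(mat_diag n f *\<^sub>v w) $ i = vec n (\<lambda>i. f i * w $ i) $ i"
    using assms by (simp add: scalar_prod_def if_distrib[of "\<lambda>x. x * _"] sum.delta cong: if_cong)
qed simp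

text \<open>An index i of the product encodes the pair \<open>(i div d, i mod d)\<close>, and two
  indices with equal pairs coincide. Hence the bold matrices stay diagonal, with every entry
  repeated d times.\<close>

lemma kronecker_mat_diag_one:
  assumes "0 < d"
  shows "mat_diag m f \<otimes>\<^sub>K 1\<^sub>m d = mat_diag (m * d) (\<lambda>i. f (i div d))"
proof (intro eq_matI)
  fix i j assume "i < dim_row (mat_diag (m * d) (\<lambda>i. f (i div d)))"
    and "j < dim_col (mat_diag (m * d) (\<lambda>i. f (i div d)))"
  then have "i div d < m" "j div d < m" "i < m * d" "j < m * d"
    by (auto simp: less_mult_imp_div_less)
  moreover have "i = j" if "i div d = j div d" "i mod d = j mod d"
    using that by (metis div_mult_mod_eq)
  ultimately show "(mat_diag m f \<otimes>\<^sub>K 1\<^sub>m d) $$ (i, j) = mat_diag (m * d) (\<lambda>i. f (i div d)) $$ (i, j)"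
    using assms by (auto simp: kronecker_def)
qed (auto simp: kronecker_def)

lemma spectral_norm_mat_diag_le:
  assumes "0 \<le> b" and "\<And>i. i < n \<Longrightarrow> \<bar>f i\<bar> \<le> b"
  shows "spectral_norm (mat_diag n f) \<le> b"
proof (rule spectral_norm_leI[OF assms(1)])
  fix v :: "real vec" assume v: "v \<in> carrier_vec (dim_col (mat_diag n f))"
  have "mat_diag n f *\<^sub>v v = vec n (\<lambda>i. f i * v $ i)"
    using v by (intro mat_diag_mult_vec) simp
  moreover have "(\<Sum>i<n. (f i * v $ i)\<^sup>2) \<le> (\<Sum>i<n. b\<^sup>2 * (v $ i)\<^sup>2)"
    unfolding power_mult_distrib
    using assms(2) by (intro sum_mono mult_right_mono) (auto intro!: abs_le_square_iff[THEN iffD1] order_trans[OF assms(2)])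
  ultimately show "(mat_diag n f *\<^sub>v v) \<bullet> (mat_diag n f *\<^sub>v v) \<le> b\<^sup>2 * (v \<bullet> v)"
    using v by (simp add: scalar_prod_def power2_eq_square sum_distrib_left lessThan_atLeast0)
qed

lemma abs_le_spectral_norm_mat_diag:
  assumes "i < n"
  shows "\<bar>f i\<bar> \<le> spectral_norm (mat_diag n f)"
  using abs_index_le_spectral_norm[of i "mat_diag n f" i] assms by simp

text \<open>\<open>minv\<close> unwraps the option returned by Gauss-Jordan elimination, so a
  one-sided inverse must be identified with that result. Elimination succeeds because A is a unit of
  the matrix ring, and uniqueness of inverses does the rest.\<close>

lemma mat_inverse_eqI:
  fixes A :: "'a :: field mat"
  assumes A: "A \<in> carrier_mat n n" and B: "B \<in> carrier_mat n n" and AB: "A * B = 1\<^sub>m n"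
  shows "mat_inverse A = Some B"
proof -
  have BA: "B * A = 1\<^sub>m n" using mat_mult_left_right_inverse[OF A B AB] .
  have "A \<in> Units (ring_mat TYPE('a) n undefined)"
    using A B AB BA by (auto simp: Units_def ring_mat_def)
  then obtain C where C: "mat_inverse A = Some C"
    using mat_inverse(1)[OF A, of undefined] by (cases "mat_inverse A") auto
  then have "C * A = 1\<^sub>m n" "C \<in> carrier_mat n n" using mat_inverse(2)[OF A C] by auto
  then have "C = C * (A * B)" using AB by auto
  also have "\<dots> = (C * A) * B" using A B \<open>C \<in> carrier_mat n n\<close> by auto
  also have "\<dots> = B" using B \<open>C * A = 1\<^sub>m n\<close> by simp
  finally show ?thesis using C by simp
qed

lemma minv_mat_diag:
  assumes "\<And>i. i < n \<Longrightarrow> f i \<noteq> 0"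
  shows "minv (mat_diag n f) = mat_diag n (\<lambda>i. 1 / f i)"
proof -
  have "mat_diag n f * mat_diag n (\<lambda>i. 1 / f i) = mat_diag n (\<lambda>i. 1)"
    unfolding mat_diag_diag using assms by (intro mat_diag_cong) auto
  then have "mat_inverse (mat_diag n f) = Some (mat_diag n (\<lambda>i. 1 / f i))"
    by (intro mat_inverse_eqI) auto
  then show ?thesis by simp
qed

text \<open>Up to a simultaneous permutation of rows and columns this is a direct sum of k
  two-by-two matrices. Keeping the four diagonals as functions turns products, inverses and norm
  bounds into computations for a single index.\<close>

definition diag_blocks ::
  "nat \<Rightarrow> (nat \<Rightarrow> real) \<Rightarrow> (nat \<Rightarrow> real) \<Rightarrow> (nat \<Rightarrow> real) \<Rightarrow> (nat \<Rightarrow> real) \<Rightarrow> real mat" where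
  "diag_blocks k a b c d =
     four_block_mat (mat_diag k a) (mat_diag k b) (mat_diag k c) (mat_diag k d)"

lemma diag_blocks_carrier [simp]: "diag_blocks k a b c d \<in> carrier_mat (k + k) (k + k)"
  by (auto simp: diag_blocks_def)

lemma diag_blocks_dims [simp]:
  "dim_row (diag_blocks k a b c d) = k + k" "dim_col (diag_blocks k a b c d) = k + k"
  by (auto simp: diag_blocks_def)

lemma diag_blocks_cong:
  assumes "\<And>i. i < k \<Longrightarrow> a i = a' i" "\<And>i. i < k \<Longrightarrow> b i = b' i"
    "\<And>i. i < k \<Longrightarrow> c i = c' i" "\<And>i. i < k \<Longrightarrow> d i = d' i"
  shows "diag_blocks k a b c d = diag_blocks k a' b' c' d'"
  unfolding diag_blocks_def using assms by (metis mat_diag_cong)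

lemma diag_blocks_mult:
  "diag_blocks k a b c d * diag_blocks k a' b' c' d' =
   diag_blocks k (\<lambda>i. a i * a' i + b i * c' i) (\<lambda>i. a i * b' i + b i * d' i)
     (\<lambda>i. c i * a' i + d i * c' i) (\<lambda>i. c i * b' i + d i * d' i)"
  unfolding diag_blocks_def
  by (subst mult_four_block_mat[of _ k k _ k _ k _ _ k _ k]) (simp_all add: mat_diag_add)

lemma diag_blocks_one: "diag_blocks k (\<lambda>_. 1) (\<lambda>_. 0) (\<lambda>_. 0) (\<lambda>_. 1) = 1\<^sub>m (k + k)"
  by (intro eq_matI) (auto simp: diag_blocks_def)

text \<open>Splitting a vector into halves x and y, the pair (x_i, y_i) is moved by the i-th
  two-by-two matrix alone, so a common bound for these small matrices carries over by
  summation.\<close>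

lemma spectral_norm_diag_blocks_le:
  assumes "0 \<le> \<beta>"
    and "\<And>i x y. i < k \<Longrightarrow> (a i * x + b i * y)\<^sup>2 + (c i * x + d i * y)\<^sup>2 \<le> \<beta>\<^sup>2 * (x\<^sup>2 + y\<^sup>2)"
  shows "spectral_norm (diag_blocks k a b c d) \<le> \<beta>"
proof (rule spectral_norm_leI[OF assms(1)])
  fix v :: "real vec" assume v: "v \<in> carrier_vec (dim_col (diag_blocks k a b c d))"
  define x where "x = vec_first v k"
  define y where "y = vec_last v k"
  have xy: "x \<in> carrier_vec k" "y \<in> carrier_vec k" "v = x @\<^sub>v y"
    using v by (auto simp: x_def y_def)
  have "diag_blocks k a b c d *\<^sub>v v =
      vec k (\<lambda>i. a i * x $ i + b i * y $ i) @\<^sub>v vec k (\<lambda>i. c i * x $ i + d i * y $ i)"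
    unfolding diag_blocks_def xy(3)
    by (subst four_block_mat_mult_vec[of _ k k _ k _ k]) (auto simp: xy mat_diag_mult_vec)
  then have "(diag_blocks k a b c d *\<^sub>v v) \<bullet> (diag_blocks k a b c d *\<^sub>v v) =
      (\<Sum>i<k. (a i * x $ i + b i * y $ i)\<^sup>2 + (c i * x $ i + d i * y $ i)\<^sup>2)"
    by (simp add: scalar_prod_append[of _ k _ k])
      (simp add: scalar_prod_def power2_eq_square lessThan_atLeast0 sum.distrib)
  also have "\<dots> \<le> (\<Sum>i<k. \<beta>\<^sup>2 * ((x $ i)\<^sup>2 + (y $ i)\<^sup>2))"
    using assms(2) by (intro sum_mono) auto
  also have "\<dots> = \<beta>\<^sup>2 * (v \<bullet> v)"
    using xy by (simp add: scalar_prod_append[of _ k _ k])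
      (simp add: scalar_prod_def power2_eq_square lessThan_atLeast0 sum.distrib sum_distrib_left distrib_left)
  finally show "(diag_blocks k a b c d *\<^sub>v v) \<bullet> (diag_blocks k a b c d *\<^sub>v v) \<le> \<beta>\<^sup>2 * (v \<bullet> v)" .
qed

subsection \<open>Spectral data of a mixing matrix\<close>

text \<open>\<open>case_nat a f\<close> prepends a to the sequence f, so the consensus direction and
  the other n - 1 directions share one diagonal matrix, with the latter shifted by one.\<close>

lemma block_diag1_mat_diag: "block_diag1 a (mat_diag m f) = mat_diag (Suc m) (case_nat a f)"
  by (intro eq_matI) (auto simp: block_diag1_def split: nat.split)

lemma orthogonal_conj_mult:
  fixes U :: "real mat"
  assumes U: "U \<in> carrier_mat n n" "U\<^sup>T * U = 1\<^sub>m n"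
    and D: "D \<in> carrier_mat n n" and E: "E \<in> carrier_mat n n"
  shows "(U * D * U\<^sup>T) * (U * E * U\<^sup>T) = U * (D * E) * U\<^sup>T"
proof -
  have Ut: "U\<^sup>T \<in> carrier_mat n n" using U by simp
  have "(U * D * U\<^sup>T) * (U * E * U\<^sup>T) = U * D * (U\<^sup>T * (U * (E * U\<^sup>T)))"
    using U(1) Ut D E by (simp add: assoc_mult_mat[of _ n n _ n _ n])
  also have "U\<^sup>T * (U * (E * U\<^sup>T)) = (U\<^sup>T * U) * (E * U\<^sup>T)"
    using U(1) Ut D E by (simp add: assoc_mult_mat[of _ n n _ n _ n])
  also have "\<dots> = E * U\<^sup>T" using U(2) E Ut by (simp add: left_mult_one_mat[of _ n n])
  also have "U * D * (E * U\<^sup>T) = U * (D * E) * U\<^sup>T"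
    using U(1) Ut D E by (simp add: assoc_mult_mat[of _ n n _ n _ n])
  finally show ?thesis .
qed

text \<open>Conjugating back with the transpose of U recovers the middle factor. This allows the
  diagonal data to be read off from equations between full matrices.\<close>

lemma orthogonal_conj_inj:
  fixes U :: "real mat"
  assumes U: "U \<in> carrier_mat n n" "U\<^sup>T * U = 1\<^sub>m n"
    and D: "D \<in> carrier_mat n n" and E: "E \<in> carrier_mat n n"
    and eq: "U * D * U\<^sup>T = U * E * U\<^sup>T"
  shows "D = E"
proof -
  have Ut: "U\<^sup>T \<in> carrier_mat n n" using U by simp
  have "U\<^sup>T * (U * X * U\<^sup>T) * U = X" if X: "X \<in> carrier_mat n n" for X
  proof -
    have "U\<^sup>T * (U * X * U\<^sup>T) * U = (U\<^sup>T * U) * X * (U\<^sup>T * U)"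
      using U(1) Ut X by (simp add: assoc_mult_mat[of _ n n _ n _ n])
    then show ?thesis using U(2) X by simp
  qed
  then show ?thesis using D E eq by metis
qed

lemma eigenbasis_diag:
  assumes "2 \<le> n" and "eigenbasis n W U"
  shows "W = U * mat_diag n (case_nat 1 (\<lambda>i. eigenvalues_desc W ! Suc i)) * U\<^sup>T"
proof -
  have "Suc (n - 1) = n" using assms(1) by simp
  then show ?thesis
    using assms(2) unfolding eigenbasis_def block_diag1_mat_diag by (elim conjE) metis
qed

lemma eigenbasisD:
  assumes "eigenbasis n W U"
  shows "U \<in> carrier_mat n n" "U\<^sup>T * U = 1\<^sub>m n" "U * U\<^sup>T = 1\<^sub>m n"
proof -
  show U: "U \<in> carrier_mat n n" "U\<^sup>T * U = 1\<^sub>m n"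
    using assms unfolding eigenbasis_def by blast+
  show "U * U\<^sup>T = 1\<^sub>m n"
    using U by (intro mat_mult_left_right_inverse[of "U\<^sup>T"]) auto
qed

section \<open>The ordered eigenvalue list and the mixing rate\<close>

lemma proots_prod_linear_factors:
  fixes xs :: "'a :: idom list"
  shows "proots (\<Prod>a\<leftarrow>xs. [:- a, 1:]) = mset xs"
proof (induction xs)
  case (Cons x xs)
  have "(\<Prod>a\<leftarrow>xs. [:- a, 1:]) \<noteq> (0 :: 'a poly)" by (auto simp: prod_list_zero_iff)
  then have "proots ([:- x, 1:] * (\<Prod>a\<leftarrow>xs. [:- a, 1:])) = {#x#} + mset xs"
    by (subst proots_mult) (simp_all only: Cons proots_linear_factor, auto)
  then show ?case by (simp del: mult_pCons_left)
qed simp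

text \<open>\<open>eigenvalues_desc\<close> collects only real roots, so its length is not evident
  from the definition. W is similar to a diagonal real matrix, whence its characteristic polynomial
  splits into n linear factors. There is no circularity in D being built from list entries: whatever
  values they have, D has n diagonal entries.\<close>

lemma length_eigenvalues_desc:
  assumes n: "2 \<le> n" and "eigenbasis n W U"
  shows "length (eigenvalues_desc W) = n"
proof -
  define D where "D = mat_diag n (case_nat 1 (\<lambda>i. eigenvalues_desc W ! Suc i))"
  note U = eigenbasisD[OF assms(2)]
  have W: "W = U * D * U\<^sup>T" unfolding D_def by (rule eigenbasis_diag[OF assms])
  have D: "D \<in> carrier_mat n n" "upper_triangular D" by (auto simp: D_def)
  have "similar_mat_wit W D U (U\<^sup>T)"
    by (rule similar_mat_witI[of _ _ n]) (use U W D in auto)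
  then have "char_poly W = char_poly D"
    by (intro char_poly_similar) (auto simp: similar_mat_def)
  also have "\<dots> = (\<Prod>a\<leftarrow>diag_mat D. [:- a, 1:])"
    using D by (intro char_poly_upper_triangular)
  also have "proots \<dots> = mset (diag_mat D)"
    by (rule proots_prod_linear_factors)
  finally have "proots (char_poly W) = mset (diag_mat D)" .
  then show ?thesis
    using D by (simp add: eigenvalues_desc_def diag_mat_def flip: size_mset)
qed

lemma lambda_min_eq:
  assumes "2 \<le> n" and "eigenbasis n W U"
  shows "lambda_min W = eigenvalues_desc W ! (n - 1)"
  using length_eigenvalues_desc[OF assms] assms(1)
  unfolding lambda_min_def by (subst last_conv_nth) auto

lemma eigenvalues_desc_mono:
  assumes "i \<le> j" and "j < length (eigenvalues_desc W)"
  shows "eigenvalues_desc W ! j \<le> eigenvalues_desc W ! i"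
  using assms sorted_nth_mono[of "sorted_list_of_multiset (proots (char_poly W))"
      "length (eigenvalues_desc W) - Suc j" "length (eigenvalues_desc W) - Suc i"]
  by (auto simp: eigenvalues_desc_def rev_nth)

lemma eigenvalue_bounds:
  assumes "2 \<le> n" and "eigenbasis n W U" and "i < n - 1"
  shows "lambda_min W \<le> eigenvalues_desc W ! Suc i"
    and "\<bar>eigenvalues_desc W ! Suc i\<bar> \<le> mixing_rate W"
proof -
  have "eigenvalues_desc W ! (n - 1) \<le> eigenvalues_desc W ! Suc i"
    and "eigenvalues_desc W ! Suc i \<le> eigenvalues_desc W ! 1"
    using assms length_eigenvalues_desc[OF assms(1,2)] by (auto intro!: eigenvalues_desc_mono)
  then show "lambda_min W \<le> eigenvalues_desc W ! Suc i"
    and "\<bar>eigenvalues_desc W ! Suc i\<bar> \<le> mixing_rate W"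
    by (auto simp: lambda_min_eq[OF assms(1,2)] mixing_rate_def)
qed

text \<open>The two candidates in the maximum are the list positions 1 and n - 1, that is
  \<open>Suc 0\<close> and \<open>Suc (n - 2)\<close>. A concrete index is needed for the lower
  bounds.\<close>

lemma mixing_rate_attained:
  assumes "2 \<le> n" and "eigenbasis n W U"
  obtains i where "i < n - 1" and "mixing_rate W = \<bar>eigenvalues_desc W ! Suc i\<bar>"
proof (cases "mixing_rate W = \<bar>eigenvalues_desc W ! 1\<bar>")
  case True
  then show ?thesis using assms(1) that[of 0] by simp
next
  case False
  moreover have "Suc (n - 2) = n - 1" using assms(1) by simp
  ultimately have "mixing_rate W = \<bar>eigenvalues_desc W ! Suc (n - 2)\<bar>"
    using lambda_min_eq[OF assms] by (auto simp: mixing_rate_def max_def split: if_splits)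
  then show ?thesis using assms(1) that[of "n - 2"] by simp
qed

text \<open>The entry of \<open>La\<close> belonging to an eigenvalue \<mu> of W. Only A needs such
  a function, since B and C are the same in all three variants.\<close>

fun gt_eigenvalue :: "gt_variant \<Rightarrow> real \<Rightarrow> real" where
  "gt_eigenvalue ATC_GT \<mu> = \<mu>\<^sup>2"
| "gt_eigenvalue Semi_ATC_GT \<mu> = \<mu>"
| "gt_eigenvalue Non_ATC_GT \<mu> = 1"

text \<open>A, B and C are polynomials in W, hence diagonal in the same basis U, and conjugation by
  U is injective. So the hypotheses determine the diagonal data completely, and the result depends
  on W but not on the chosen U.\<close>

lemma spectral_data_unique:
  assumes n: "2 \<le> n" and eb: "eigenbasis n W U" and rate: "mixing_rate W < 1"
    and sd: "spectral_data n U (mat_A v W) (mat_B W) (mat_C W) La Lb Lc"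
  defines "\<mu> \<equiv> \<lambda>i. eigenvalues_desc W ! Suc i"
  shows "La = mat_diag (n - 1) (\<lambda>i. gt_eigenvalue v (\<mu> i))"
    and "Lb = mat_diag (n - 1) (\<lambda>i. 1 - \<mu> i)"
    and "Lc = mat_diag (n - 1) (\<lambda>i. (\<mu> i)\<^sup>2)"
proof -
  note U = eigenbasisD[OF eb]
  have Suc_n: "Suc (n - 1) = n" using n by simp
  have W: "W = U * mat_diag n (case_nat 1 \<mu>) * U\<^sup>T"
    unfolding \<mu>_def by (rule eigenbasis_diag[OF n eb])
  have dim_W: "dim_row W = n" using U by (subst W) auto
  have one: "U * mat_diag n (\<lambda>_. 1) * U\<^sup>T = 1\<^sub>m n" using U by simp
  have WW: "W * W = U * mat_diag n (\<lambda>i. case_nat 1 \<mu> i * case_nat 1 \<mu> i) * U\<^sup>T"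
    by (subst (1 2) W, subst orthogonal_conj_mult[OF U(1,2)]) auto
  \<comment> \<open>Position 0 is the consensus direction and is discarded; position
    \<open>Suc i\<close> of the full diagonal is entry i of the reduced one.\<close>
  have diag_eq: "\<forall>i<n - 1. f i = g (Suc i)"
    if "U * block_diag1 a (mat_diag (n - 1) f) * U\<^sup>T = U * mat_diag n g * U\<^sup>T" for a f g
  proof -
    have "mat_diag n (case_nat a f) = mat_diag n g"
      using that unfolding block_diag1_mat_diag Suc_n
      by (rule orthogonal_conj_inj[OF U(1,2), rotated 2]) auto
    then have "case_nat a f (Suc i) = g (Suc i)" if "i < n - 1" for i
      using that n unfolding mat_diag_eq_iff by (auto dest!: spec[of _ "Suc i"])
    then show ?thesis by simp
  qed
  have La: "La = mat_diag (n - 1) (\<lambda>i. La $$ (i, i))"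
    and Lb: "Lb = mat_diag (n - 1) (\<lambda>i. Lb $$ (i, i))"
    and Lc: "Lc = mat_diag (n - 1) (\<lambda>i. Lc $$ (i, i))"
    using sd unfolding spectral_data_def by (blast intro: diagonal_mat_eq_mat_diag)+
  have eqs: "mat_A v W = U * block_diag1 1 La * U\<^sup>T"
    "mat_B W * mat_B W = U * block_diag1 0 (Lb * Lb) * U\<^sup>T"
    "mat_C W = U * block_diag1 1 Lc * U\<^sup>T"
    and Lb_pos: "\<And>i. i < n - 1 \<Longrightarrow> 0 < Lb $$ (i, i)"
    using sd unfolding spectral_data_def by blast+
  have "mat_A v W = U * mat_diag n (\<lambda>i. gt_eigenvalue v (case_nat 1 \<mu> i)) * U\<^sup>T"
  proof (cases v)
    case ATC_GT
    then show ?thesis using WW by (simp add: power2_eq_square)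
  next
    case Semi_ATC_GT
    then show ?thesis using W by simp
  next
    case Non_ATC_GT
    then show ?thesis using one dim_W by (simp del: mat_diag_one)
  qed
  with eqs(1) have "\<forall>i<n - 1. La $$ (i, i) = gt_eigenvalue v (case_nat 1 \<mu> (Suc i))"
    by (intro diag_eq[of 1]) (simp only: La[symmetric])
  then show "La = mat_diag (n - 1) (\<lambda>i. gt_eigenvalue v (\<mu> i))"
    by (subst La) (auto intro: mat_diag_cong)
  have "\<forall>i<n - 1. Lc $$ (i, i) = case_nat 1 \<mu> (Suc i) * case_nat 1 \<mu> (Suc i)"
    using eqs(3) WW by (intro diag_eq[of 1]) (simp only: mat_C_def Lc[symmetric])
  then show "Lc = mat_diag (n - 1) (\<lambda>i. (\<mu> i)\<^sup>2)"
    by (subst Lc) (auto intro: mat_diag_cong simp: power2_eq_square)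
  have B: "mat_B W = U * mat_diag n (\<lambda>i. 1 - case_nat 1 \<mu> i) * U\<^sup>T"
  proof -
    have "mat_B W = U * mat_diag n (\<lambda>_. 1) * U\<^sup>T - U * mat_diag n (case_nat 1 \<mu>) * U\<^sup>T"
      using dim_W by (simp only: one W[symmetric] mat_B_def)
    also have "\<dots> = U * (mat_diag n (\<lambda>_. 1) - mat_diag n (case_nat 1 \<mu>)) * U\<^sup>T"
      using U by (simp add: mult_minus_distrib_mat[of _ n n _ n] minus_mult_distrib_mat[of _ n n _ _ n])
    finally show ?thesis by (simp add: mat_diag_minus del: mat_diag_one)
  qed
  have "mat_B W * mat_B W =
      U * mat_diag n (\<lambda>i. (1 - case_nat 1 \<mu> i) * (1 - case_nat 1 \<mu> i)) * U\<^sup>T"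
    by (subst (1 2) B, subst orthogonal_conj_mult[OF U(1,2)]) auto
  moreover have "Lb * Lb = mat_diag (n - 1) (\<lambda>i. Lb $$ (i, i) * Lb $$ (i, i))"
    by (subst (1 2) Lb) simp
  ultimately have "\<forall>i<n - 1. Lb $$ (i, i) * Lb $$ (i, i) = (1 - case_nat 1 \<mu> (Suc i)) * (1 - case_nat 1 \<mu> (Suc i))"
    using eqs(2) by (intro diag_eq[of 0]) simp
  moreover have "\<mu> i < 1" if "i < n - 1" for i
    using eigenvalue_bounds(2)[OF n eb that] rate by (simp add: \<mu>_def)
  \<comment> \<open>Only the square of \<open>Lb\<close> is prescribed. Both candidates for the root
    are positive, because \<mu> < 1, so they agree.\<close>
  ultimately have "Lb $$ (i, i) = 1 - \<mu> i" if "i < n - 1" for i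
    using that Lb_pos[OF that] power2_eq_imp_eq[of "Lb $$ (i, i)" "1 - \<mu> i"]
    by (auto simp: power2_eq_square less_imp_le)
  then show "Lb = mat_diag (n - 1) (\<lambda>i. 1 - \<mu> i)"
    by (subst Lb) (auto intro: mat_diag_cong)
qed

subsection \<open>The scaled Jordan basis\<close>

text \<open>A rescaled Jordan chain: (1, -1) spans the kernel of N, and N maps (1, 1) to -2 (1, -1).
  Shrinking the second vector by \<epsilon> shrinks the off-diagonal entry equally, at the price of
  a factor 1/\<epsilon> in the inverse.\<close>

definition jordan_basis :: "nat \<Rightarrow> real \<Rightarrow> real mat" where
  "jordan_basis k \<epsilon> = diag_blocks k (\<lambda>_. 1) (\<lambda>_. \<epsilon>) (\<lambda>_. - 1) (\<lambda>_. \<epsilon>)"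

definition jordan_basis_inv :: "nat \<Rightarrow> real \<Rightarrow> real mat" where
  "jordan_basis_inv k \<epsilon> =
     diag_blocks k (\<lambda>_. 1 / 2) (\<lambda>_. - 1 / 2) (\<lambda>_. 1 / (2 * \<epsilon>)) (\<lambda>_. 1 / (2 * \<epsilon>))"

lemma jordan_basis_carrier [simp]: "jordan_basis k \<epsilon> \<in> carrier_mat (k + k) (k + k)"
  by (simp add: jordan_basis_def)

lemma jordan_basis_inv_carrier [simp]: "jordan_basis_inv k \<epsilon> \<in> carrier_mat (k + k) (k + k)"
  by (simp add: jordan_basis_inv_def)

lemma jordan_basis_inverse:
  assumes "\<epsilon> \<noteq> 0"
  shows "minv (jordan_basis k \<epsilon>) = jordan_basis_inv k \<epsilon>"
    and "jordan_basis k \<epsilon> * jordan_basis_inv k \<epsilon> = 1\<^sub>m (k + k)" and "jordan_basis_inv k \<epsilon> * jordan_basis k \<epsilon> = 1\<^sub>m (k + k)"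
proof -
  show PQ: "jordan_basis k \<epsilon> * jordan_basis_inv k \<epsilon> = 1\<^sub>m (k + k)"
    unfolding jordan_basis_inv_def jordan_basis_def diag_blocks_mult diag_blocks_one[symmetric]
    using assms(1) by (intro diag_blocks_cong) auto
  show "jordan_basis_inv k \<epsilon> * jordan_basis k \<epsilon> = 1\<^sub>m (k + k)"
    unfolding jordan_basis_inv_def jordan_basis_def diag_blocks_mult diag_blocks_one[symmetric]
    using assms(1) by (intro diag_blocks_cong) auto
  have "mat_inverse (jordan_basis k \<epsilon>) = Some (jordan_basis_inv k \<epsilon>)"
    by (rule mat_inverse_eqI[OF _ _ PQ]) (auto simp: jordan_basis_inv_def)
  then show "minv (jordan_basis k \<epsilon>) = jordan_basis_inv k \<epsilon>" by simp
qed

lemma invertible_jordan_basis: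
  assumes "\<epsilon> \<noteq> 0"
  shows "invertible_mat (jordan_basis k \<epsilon>)"
  unfolding invertible_mat_def inverts_mat_def
  using jordan_basis_inverse(2,3)[OF assms, of k] jordan_basis_carrier[of k \<epsilon>]
  by (intro conjI exI[of _ "jordan_basis_inv k \<epsilon>"])
    (auto simp: jordan_basis_def jordan_basis_inv_def)

text \<open>In each block the two columns are orthogonal with squared lengths 2 and 2 \<epsilon>^2.
  The exact norm is therefore sqrt 2 for \<epsilon> \<le> 1; the value 2 avoids the root.\<close>

lemma spectral_norm_jordan_basis_le:
  assumes "0 < \<epsilon>" and "\<epsilon> \<le> 1"
  shows "spectral_norm (jordan_basis k \<epsilon>) \<le> 2"
  unfolding jordan_basis_def
proof (rule spectral_norm_diag_blocks_le)
  fix x y :: real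
  have "\<epsilon>\<^sup>2 * y\<^sup>2 \<le> 1 * y\<^sup>2"
    using assms by (intro mult_right_mono) (auto simp: power_le_one)
  moreover have "(1 * x + \<epsilon> * y)\<^sup>2 + (- 1 * x + \<epsilon> * y)\<^sup>2 = 2 * x\<^sup>2 + 2 * (\<epsilon>\<^sup>2 * y\<^sup>2)"
    by (simp add: power2_eq_square algebra_simps)
  ultimately have "(1 * x + \<epsilon> * y)\<^sup>2 + (- 1 * x + \<epsilon> * y)\<^sup>2 \<le> 2 * x\<^sup>2 + 2 * y\<^sup>2" by simp
  also have "\<dots> \<le> 2\<^sup>2 * (x\<^sup>2 + y\<^sup>2)" by simp
  finally show "(1 * x + \<epsilon> * y)\<^sup>2 + (- 1 * x + \<epsilon> * y)\<^sup>2 \<le> 2\<^sup>2 * (x\<^sup>2 + y\<^sup>2)" .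
qed simp

text \<open>The weight 1/\<epsilon> of the second row dominates that of the first, and after
  enlarging the first row accordingly the parallelogram identity finishes the estimate.\<close>

lemma spectral_norm_minv_jordan_basis_le:
  assumes "0 < \<epsilon>" and "\<epsilon> \<le> 1"
  shows "spectral_norm (minv (jordan_basis k \<epsilon>)) \<le> 1 / \<epsilon>"
proof -
  have "spectral_norm (jordan_basis_inv k \<epsilon>) \<le> 1 / \<epsilon>"
    unfolding jordan_basis_inv_def
  proof (rule spectral_norm_diag_blocks_le)
    fix x y :: real
    have "(x - y)\<^sup>2 / 4 * 1 \<le> (x - y)\<^sup>2 / 4 * (1 / \<epsilon>)\<^sup>2"
      using assms by (intro mult_left_mono) (auto intro!: one_le_power)
    moreover have "(1 / 2 * x + - 1 / 2 * y)\<^sup>2 = (x - y)\<^sup>2 / 4 * 1"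
      by (simp add: power2_eq_square field_simps)
    moreover have "(1 / (2 * \<epsilon>) * x + 1 / (2 * \<epsilon>) * y)\<^sup>2 = (x + y)\<^sup>2 / 4 * (1 / \<epsilon>)\<^sup>2"
      using assms by (simp add: power2_eq_square field_simps)
    ultimately have "(1 / 2 * x + - 1 / 2 * y)\<^sup>2 + (1 / (2 * \<epsilon>) * x + 1 / (2 * \<epsilon>) * y)\<^sup>2
        \<le> (x - y)\<^sup>2 / 4 * (1 / \<epsilon>)\<^sup>2 + (x + y)\<^sup>2 / 4 * (1 / \<epsilon>)\<^sup>2" by linarith
    also have "\<dots> = (1 / \<epsilon>)\<^sup>2 * (((x - y)\<^sup>2 + (x + y)\<^sup>2) / 4)"
      by (simp add: algebra_simps add_divide_distrib)
    also have "((x - y)\<^sup>2 + (x + y)\<^sup>2) / 4 = (x\<^sup>2 + y\<^sup>2) / 2"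
      by (simp add: power2_eq_square field_simps)
    also have "(1 / \<epsilon>)\<^sup>2 * ((x\<^sup>2 + y\<^sup>2) / 2) \<le> (1 / \<epsilon>)\<^sup>2 * (x\<^sup>2 + y\<^sup>2)"
      by (intro mult_left_mono) auto
    finally show "(1 / 2 * x + - 1 / 2 * y)\<^sup>2 + (1 / (2 * \<epsilon>) * x + 1 / (2 * \<epsilon>) * y)\<^sup>2
        \<le> (1 / \<epsilon>)\<^sup>2 * (x\<^sup>2 + y\<^sup>2)" .
  qed (use assms in simp)
  then show ?thesis using assms by (simp add: jordan_basis_inverse(1))
qed

text \<open>The squares cancel in \<mu>^2 - (1 - \<mu>)^2 = 2 \<mu> - 1. The block is thus affine in
  \<mu>, which is why one basis serves all eigenvalues.\<close>

lemma iteration_matrix_mat_diag: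
  "iteration_matrix (mat_diag k (\<lambda>i. 1 - m i)) (mat_diag k (\<lambda>i. (m i)\<^sup>2)) =
   diag_blocks k (\<lambda>i. 2 * m i - 1) (\<lambda>i. m i - 1) (\<lambda>i. 1 - m i) (\<lambda>_. 1)"
proof -
  have "mat_diag k (\<lambda>i. (m i)\<^sup>2) - mat_diag k (\<lambda>i. 1 - m i) * mat_diag k (\<lambda>i. 1 - m i) =
      mat_diag k (\<lambda>i. 2 * m i - 1)"
    unfolding mat_diag_diag mat_diag_minus
    by (intro mat_diag_cong) (simp add: power2_eq_square algebra_simps)
  moreover have "- mat_diag k (\<lambda>i. 1 - m i) = mat_diag k (\<lambda>i. m i - 1)"
    unfolding mat_diag_uminus by (intro mat_diag_cong) simp
  ultimately show ?thesis by (simp add: iteration_matrix_def diag_blocks_def)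
qed

lemma jordan_form_iteration_matrix:
  fixes k :: nat and m :: "nat \<Rightarrow> real" and \<epsilon> :: real
  assumes "\<epsilon> \<noteq> 0"
  defines "P \<equiv> jordan_basis k \<epsilon>"
  defines "M \<equiv> diag_blocks k (\<lambda>i. 2 * m i - 1) (\<lambda>i. m i - 1) (\<lambda>i. 1 - m i) (\<lambda>_. 1)"
  shows "minv P * M * P = diag_blocks k m (\<lambda>i. - 2 * \<epsilon> * (1 - m i)) (\<lambda>_. 0) m"
    and "M = P * (minv P * M * P) * minv P"
proof -
  show "minv P * M * P = diag_blocks k m (\<lambda>i. - 2 * \<epsilon> * (1 - m i)) (\<lambda>_. 0) m"
    unfolding P_def jordan_basis_inverse(1)[OF assms(1)] M_def
    unfolding jordan_basis_def jordan_basis_inv_def diag_blocks_mult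
    using assms(1) by (intro diag_blocks_cong) (auto simp: field_simps)
  have carr: "P \<in> carrier_mat (k + k) (k + k)" "minv P \<in> carrier_mat (k + k) (k + k)"
    "M \<in> carrier_mat (k + k) (k + k)"
    unfolding P_def jordan_basis_inverse(1)[OF assms(1)] M_def by auto
  have PQ: "P * minv P = 1\<^sub>m (k + k)"
    unfolding P_def jordan_basis_inverse(1)[OF assms(1)] by (rule jordan_basis_inverse(2)[OF assms(1)])
  have "P * (minv P * M * P) * minv P = (P * minv P) * M * (P * minv P)"
    using carr by (simp add: assoc_mult_mat[of _ "k + k" "k + k" _ "k + k" _ "k + k"])
  then show "M = P * (minv P * M * P) * minv P" using carr by (simp add: PQ)
qed

text \<open>The triangle inequality for a scalar block plus a coupling of size t = 2 \<epsilon> (1 -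
  \<mu>), carried out on squares; \<mu> \<le> 1 makes t nonnegative, and the cross term is absorbed
  by |x y| \<le> x^2 + y^2.\<close>

lemma spectral_norm_jordan_form_le:
  assumes "0 \<le> \<epsilon>" and "0 \<le> \<beta>"
    and "\<And>i. i < k \<Longrightarrow> m i \<le> 1"
    and "\<And>i. i < k \<Longrightarrow> \<bar>m i\<bar> + 2 * \<epsilon> * (1 - m i) \<le> \<beta>"
  shows "spectral_norm (diag_blocks k m (\<lambda>i. - 2 * \<epsilon> * (1 - m i)) (\<lambda>_. 0) m) \<le> \<beta>"
proof (rule spectral_norm_diag_blocks_le[OF assms(2)])
  fix i and x y :: real assume i: "i < k"
  define t where "t = 2 * \<epsilon> * (1 - m i)"
  have t: "0 \<le> t" using assms(1) assms(3)[OF i] by (simp add: t_def)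
  have "(m i * x + - 2 * \<epsilon> * (1 - m i) * y)\<^sup>2 + (0 * x + m i * y)\<^sup>2
      = (m i)\<^sup>2 * (x\<^sup>2 + y\<^sup>2) - 2 * (m i * t * (x * y)) + t\<^sup>2 * y\<^sup>2"
    by (simp add: t_def power2_eq_square algebra_simps)
  also have "\<dots> \<le> (m i)\<^sup>2 * (x\<^sup>2 + y\<^sup>2) + 2 * (\<bar>m i\<bar> * t * (x\<^sup>2 + y\<^sup>2)) + t\<^sup>2 * (x\<^sup>2 + y\<^sup>2)"
  proof -
    have "\<bar>x * y\<bar> \<le> x\<^sup>2 + y\<^sup>2"
      using sum_squares_bound[of "\<bar>x\<bar>" "\<bar>y\<bar>"] abs_ge_zero[of "x * y"]
      unfolding abs_mult power2_abs by linarith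
    then have "\<bar>m i\<bar> * t * \<bar>x * y\<bar> \<le> \<bar>m i\<bar> * t * (x\<^sup>2 + y\<^sup>2)"
      using t by (intro mult_left_mono) auto
    moreover have "- (m i * t * (x * y)) \<le> \<bar>m i\<bar> * t * \<bar>x * y\<bar>"
      using t abs_ge_minus_self[of "m i * t * (x * y)"] by (simp add: abs_mult)
    moreover have "t\<^sup>2 * y\<^sup>2 \<le> t\<^sup>2 * (x\<^sup>2 + y\<^sup>2)" by (intro mult_left_mono) auto
    ultimately show ?thesis by linarith
  qed
  also have "\<dots> = (\<bar>m i\<bar> + t)\<^sup>2 * (x\<^sup>2 + y\<^sup>2)"
    by (simp add: power2_eq_square algebra_simps)
  also have "\<dots> \<le> \<beta>\<^sup>2 * (x\<^sup>2 + y\<^sup>2)"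
    using assms(4)[OF i] t by (intro mult_right_mono power_mono) (auto simp: t_def)
  finally show "(m i * x + - 2 * \<epsilon> * (1 - m i) * y)\<^sup>2 + (0 * x + m i * y)\<^sup>2 \<le> \<beta>\<^sup>2 * (x\<^sup>2 + y\<^sup>2)" .
qed

subsection \<open>Norm bounds for the SPARKLE matrices\<close>

text \<open>For \<mu> \<ge> 0 the coupling is at most half of 1 - \<mu>, using c \<le> 1. For \<mu>
  < 0 it is at most c/2, and c \<le> 1 + \<mu> = 1 - |\<mu>|. The divisor 8 is chosen for the second
  case.\<close>

lemma scaled_coupling_bound:
  fixes c \<mu> \<rho> :: real
  assumes "0 < c" "c \<le> 1" "c \<le> 1 + \<mu>" "\<bar>\<mu>\<bar> \<le> \<rho>" "\<rho> < 1"
  shows "\<bar>\<mu>\<bar> + 2 * (c / 8) * (1 - \<mu>) \<le> (1 + \<rho>) / 2"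
proof (cases "0 \<le> \<mu>")
  case True
  have "c / 4 * (1 - \<mu>) \<le> 1 / 2 * (1 - \<mu>)" using assms by (intro mult_right_mono) auto
  moreover have "\<bar>\<mu>\<bar> = \<mu>" using True by simp
  ultimately show ?thesis using assms by (simp add: field_simps)
next
  case False
  have "c / 4 * (1 - \<mu>) \<le> c / 4 * 2" using assms by (intro mult_left_mono) auto
  moreover have "\<bar>\<mu>\<bar> = - \<mu>" using False by simp
  ultimately show ?thesis using assms by (simp add: field_simps)
qed

text \<open>The lower bound is the value for the ATC variant, the smallest of the three; the upper
  bound is the value for the non-ATC variant.\<close>

lemma gt_eigenvalue_bounds:
  assumes "\<bar>\<mu>\<bar> \<le> 1"
  shows "\<mu>\<^sup>2 \<le> \<bar>gt_eigenvalue v \<mu>\<bar>" and "\<bar>gt_eigenvalue v \<mu>\<bar> \<le> 1"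
proof -
  have "\<mu>\<^sup>2 \<le> \<bar>\<mu>\<bar>"
    using assms mult_right_mono[of "\<bar>\<mu>\<bar>" 1 "\<bar>\<mu>\<bar>"] by (simp add: power2_eq_square)
  then show "\<mu>\<^sup>2 \<le> \<bar>gt_eigenvalue v \<mu>\<bar>" "\<bar>gt_eigenvalue v \<mu>\<bar> \<le> 1"
    using assms by (cases v; simp)+
qed

text \<open>Everything the later estimates need about one variable. The size of the basis is
  recovered as half of the row count of M, which makes P and \<Gamma> functions of M and c alone, so
  equal iteration matrices get equal factors. The bound 16/c is the product of 2 and
  1/(c/8).\<close>

lemma sparkle_norm_bounds:
  fixes c :: real
  assumes c: "0 < c" "c \<le> 1" "c \<le> 1 + lambda_min W"
    and n: "2 \<le> n" and d: "1 \<le> d" and eb: "eigenbasis n W U" and rate: "mixing_rate W < 1"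
    and sd: "spectral_data n U (mat_A v W) (mat_B W) (mat_C W) La Lb Lc"
  defines "M \<equiv> iteration_matrix (bold d Lb) (bold d Lc)"
  defines "P \<equiv> jordan_basis (dim_row M div 2) (c / 8)"
  defines "\<Gamma> \<equiv> minv P * M * P"
  shows "factorization M P \<Gamma>"
    and "1 \<le> spectral_norm P * spectral_norm (minv P)"
    and "spectral_norm P * spectral_norm (minv P) \<le> 16 / c"
    and "(1 - mixing_rate W) / 2 \<le> 1 - spectral_norm \<Gamma>"
    and "1 - spectral_norm \<Gamma> \<le> 1 - mixing_rate W"
    and "(mixing_rate W)\<^sup>2 \<le> spectral_norm (bold d La)"
    and "spectral_norm (bold d La) \<le> 1"
    and "c / 2 / (1 - mixing_rate W) \<le> spectral_norm (minv (bold d Lb))"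
    and "spectral_norm (minv (bold d Lb)) \<le> 1 / (1 - mixing_rate W)"
    and "0 \<le> mixing_rate W"
proof -
  define k where "k = (n - 1) * d"
  define \<mu> where "\<mu> = (\<lambda>i. eigenvalues_desc W ! Suc i)"
  define m where "m = (\<lambda>i. \<mu> (i div d))"
  define \<rho> where "\<rho> = mixing_rate W"
  have k: "0 < k" using n d by (simp add: k_def)
  note L = spectral_data_unique[OF n eb rate sd]
  have La: "bold d La = mat_diag k (\<lambda>i. gt_eigenvalue v (m i))"
    and Lb: "bold d Lb = mat_diag k (\<lambda>i. 1 - m i)"
    and Lc: "bold d Lc = mat_diag k (\<lambda>i. (m i)\<^sup>2)"
    using d by (auto simp: L kronecker_mat_diag_one k_def m_def \<mu>_def)
  have M: "M = diag_blocks k (\<lambda>i. 2 * m i - 1) (\<lambda>i. m i - 1) (\<lambda>i. 1 - m i) (\<lambda>_. 1)"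
    unfolding M_def Lb Lc by (rule iteration_matrix_mat_diag)
  have P: "P = jordan_basis k (c / 8)" by (simp add: P_def M flip: mult_2)
  have eps: "c / 8 \<noteq> 0" "0 < c / 8" "c / 8 \<le> 1" using c by auto
  have \<Gamma>: "\<Gamma> = diag_blocks k m (\<lambda>i. - 2 * (c / 8) * (1 - m i)) (\<lambda>_. 0) m"
    unfolding \<Gamma>_def P M by (rule jordan_form_iteration_matrix(1)[OF eps(1)])
  have m: "c \<le> 1 + m i" "\<bar>m i\<bar> \<le> \<rho>" if "i < k" for i
  proof -
    have "i div d < n - 1" using that by (simp add: k_def less_mult_imp_div_less)
    then show "c \<le> 1 + m i" "\<bar>m i\<bar> \<le> \<rho>"
      using eigenvalue_bounds[OF n eb, of "i div d"] c by (auto simp: m_def \<mu>_def \<rho>_def)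
  qed
  have \<rho>1: "\<rho> < 1" using rate by (simp add: \<rho>_def)
  \<comment> \<open>The eigenvalue at position j occupies d consecutive diagonal places of the bold
    matrices; \<open>j * d\<close> is the first of them.\<close>
  obtain i where i: "i < k" "\<rho> = \<bar>m i\<bar>"
  proof -
    obtain j where j: "j < n - 1" "mixing_rate W = \<bar>eigenvalues_desc W ! Suc j\<bar>"
      using mixing_rate_attained[OF n eb] .
    have "j * d < k" using j d by (simp add: k_def)
    then show thesis using j d by (intro that[of "j * d"]) (auto simp: m_def \<mu>_def \<rho>_def)
  qed
  then have \<rho>0: "0 \<le> \<rho>" by simp
  then show "0 \<le> mixing_rate W" by (simp add: \<rho>_def)
  have m1: "\<bar>m i\<bar> \<le> 1" if "i < k" for i using m(2)[OF that] \<rho>1 by simp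
  have \<Gamma>_le: "spectral_norm \<Gamma> \<le> (1 + \<rho>) / 2"
    unfolding \<Gamma> using c \<rho>0 \<rho>1 m m1
    by (intro spectral_norm_jordan_form_le scaled_coupling_bound) (auto simp: abs_le_iff)
  then show "(1 - mixing_rate W) / 2 \<le> 1 - spectral_norm \<Gamma>"
    unfolding \<rho>_def[symmetric] by (simp add: field_simps)
  \<comment> \<open>The diagonal of the triangular form carries the eigenvalues themselves, so the
    norm of \<Gamma> cannot drop below \<rho>.\<close>
  have "\<bar>\<Gamma> $$ (i, i)\<bar> \<le> spectral_norm \<Gamma>"
    using i by (intro abs_index_le_spectral_norm) (auto simp: \<Gamma>)
  moreover have "\<Gamma> $$ (i, i) = m i" using i by (simp add: \<Gamma> diag_blocks_def)
  ultimately show "1 - spectral_norm \<Gamma> \<le> 1 - mixing_rate W"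
    using i by (simp flip: \<rho>_def)
  show "factorization M P \<Gamma>"
    unfolding factorization_def
  proof (intro conjI)
    show "M = P * \<Gamma> * minv P"
      unfolding \<Gamma>_def P M by (rule jordan_form_iteration_matrix(2)[OF eps(1)])
    show "invertible_mat P" unfolding P by (rule invertible_jordan_basis[OF eps(1)])
    show "spectral_norm \<Gamma> < 1" using \<Gamma>_le \<rho>1 by simp
  qed (auto simp: M P \<Gamma>)
  show "1 \<le> spectral_norm P * spectral_norm (minv P)"
    unfolding P using k jordan_basis_inverse[OF eps(1), of k]
    by (intro one_le_spectral_norm_mult_inverse[of _ "k + k"]) auto
  have "spectral_norm P * spectral_norm (minv P) \<le> 2 * (1 / (c / 8))"
    unfolding P using eps
    by (intro mult_mono spectral_norm_jordan_basis_le spectral_norm_minv_jordan_basis_le) auto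
  then show "spectral_norm P * spectral_norm (minv P) \<le> 16 / c" by simp
  show "spectral_norm (bold d La) \<le> 1"
    unfolding La using m1 by (intro spectral_norm_mat_diag_le gt_eigenvalue_bounds(2)) auto
  have "\<rho>\<^sup>2 = (m i)\<^sup>2" using i by simp
  also have "\<dots> \<le> \<bar>gt_eigenvalue v (m i)\<bar>" by (rule gt_eigenvalue_bounds(1)[OF m1[OF i(1)]])
  also have "\<dots> \<le> spectral_norm (bold d La)"
    unfolding La by (rule abs_le_spectral_norm_mat_diag[OF i(1)])
  finally show "(mixing_rate W)\<^sup>2 \<le> spectral_norm (bold d La)" by (simp flip: \<rho>_def)
  have pos: "0 < 1 - m i" if "i < k" for i using m(2)[OF that] \<rho>1 by auto
  have inv_Lb: "minv (bold d Lb) = mat_diag k (\<lambda>i. 1 / (1 - m i))"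
    unfolding Lb using pos by (intro minv_mat_diag) force
  have "\<bar>1 / (1 - m i)\<bar> \<le> 1 / (1 - \<rho>)" if "i < k" for i
    using pos[OF that] m(2)[OF that] \<rho>1 by (simp add: frac_le)
  then show "spectral_norm (minv (bold d Lb)) \<le> 1 / (1 - mixing_rate W)"
    unfolding inv_Lb using \<rho>1 by (intro spectral_norm_mat_diag_le) (auto simp flip: \<rho>_def)
  \<comment> \<open>If \<open>\<rho>\<close> is attained at a negative eigenvalue, then \<open>1 - \<rho> \<ge> c\<close>.\<close>
  have "c * (1 - m i) \<le> 2 * (1 - \<rho>)"
  proof (cases "0 \<le> m i")
    case True
    have "c * (1 - m i) \<le> 2 * (1 - m i)"
      using c pos[OF i(1)] by (intro mult_right_mono) auto
    then show ?thesis using True i by simp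
  next
    case False
    have "c * (1 - m i) \<le> c * 2" using c m1[OF i(1)] by (intro mult_left_mono) auto
    then show ?thesis using False i m(1)[OF i(1)] by simp
  qed
  then have "c / 2 / (1 - \<rho>) \<le> \<bar>1 / (1 - m i)\<bar>"
    using pos[OF i(1)] \<rho>1 by (simp add: field_simps)
  also have "\<dots> \<le> spectral_norm (minv (bold d Lb))"
    unfolding inv_Lb by (rule abs_le_spectral_norm_mat_diag[OF i(1)])
  finally show "c / 2 / (1 - mixing_rate W) \<le> spectral_norm (minv (bold d Lb))"
    by (simp flip: \<rho>_def)
qed

section \<open>Estimates for the network quantities in powers of the spectral gap\<close>

lemma over_powr:
  fixes D u :: real
  shows "0 < D \<Longrightarrow> u / D\<^sup>2 = u * D powr (- 2)"
    and "u / D powr (8 / 3) = u * D powr (- 8 / 3)"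
  using powr_minus_divide[of D 2] powr_minus_divide[of D "8 / 3"] by (simp_all add: powr_numeral)

text \<open>Since a \<ge> 1, the expression for x is dominated by the one for y and z, so one upper
  bound covers all variables; 4 \<kappa>^4 is the square of \<kappa>^2 divided by 1/2. The factor
  \<rho>^4 below is the square of the lower bound \<rho>^2 for the norm of L.\<close>

lemma delta_bounds:
  fixes P \<Gamma> L :: "real mat" and \<kappa> \<rho> :: real
  defines "a \<equiv> spectral_norm P * spectral_norm (minv P)" and "g \<equiv> 1 - spectral_norm \<Gamma>"
  assumes a: "1 \<le> a" "a \<le> \<kappa>" and g: "(1 - \<rho>) / 2 \<le> g" "g \<le> 1 - \<rho>"
    and L: "\<rho>\<^sup>2 \<le> spectral_norm L" "spectral_norm L \<le> 1" and \<rho>: "0 \<le> \<rho>" "\<rho> < 1"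
  shows "delta s P \<Gamma> L \<le> 4 * \<kappa> ^ 4 * (1 - \<rho>) powr (- 2)"
    and "s \<noteq> Var_x \<Longrightarrow> \<rho> ^ 4 * (1 - \<rho>) powr (- 2) \<le> delta s P \<Gamma> L"
proof -
  have D: "0 < 1 - \<rho>" "0 < g" using \<rho> g by auto
  have y: "delta s P \<Gamma> L = (a\<^sup>2 / g)\<^sup>2 * (spectral_norm L)\<^sup>2" if "s \<noteq> Var_x" for s
    using that by (cases s) (simp_all add: a_def g_def power_mult_distrib)
  have x: "delta Var_x P \<Gamma> L = (a / g)\<^sup>2 * (spectral_norm L)\<^sup>2"
    by (simp add: a_def g_def power_mult_distrib power_divide)
  have "a \<le> a\<^sup>2" using a by (simp add: power2_eq_square)
  then have "a / g \<le> a\<^sup>2 / g" using D by (intro divide_right_mono) auto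
  then have "(a / g)\<^sup>2 * (spectral_norm L)\<^sup>2 \<le> (a\<^sup>2 / g)\<^sup>2 * (spectral_norm L)\<^sup>2"
    using a D by (intro mult_right_mono power_mono) auto
  then have "delta s P \<Gamma> L \<le> (a\<^sup>2 / g)\<^sup>2 * (spectral_norm L)\<^sup>2"
    using x y by (cases "s = Var_x") auto
  also have "\<dots> \<le> (\<kappa>\<^sup>2 / ((1 - \<rho>) / 2))\<^sup>2 * 1\<^sup>2"
    using a g L D by (intro mult_mono power_mono frac_le) auto
  also have "\<dots> = 4 * \<kappa> ^ 4 / (1 - \<rho>)\<^sup>2"
    by (simp add: power2_eq_square power4_eq_xxxx)
  also have "\<dots> = 4 * \<kappa> ^ 4 * (1 - \<rho>) powr (- 2)"
    by (rule over_powr(1)[OF D(1)])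
  finally show "delta s P \<Gamma> L \<le> 4 * \<kappa> ^ 4 * (1 - \<rho>) powr (- 2)" .
  show "\<rho> ^ 4 * (1 - \<rho>) powr (- 2) \<le> delta s P \<Gamma> L" if "s \<noteq> Var_x"
  proof -
    have "1 \<le> a\<^sup>2" using a by simp
    then have "(1 / (1 - \<rho>))\<^sup>2 * (\<rho>\<^sup>2)\<^sup>2 \<le> (a\<^sup>2 / g)\<^sup>2 * (spectral_norm L)\<^sup>2"
      using g L D by (intro mult_mono power_mono frac_le) auto
    then show ?thesis
      by (simp add: y[OF that] power_one_over flip: over_powr(1)[OF D(1)])
  qed
qed

text \<open>With l of order 1/D and g of order D, where D = 1 - \<rho>, the quotient l^2/g has order
  D^-3 and its power 2/3 has order D^-2, the same as l/g; the power 4/3 of l/g gives D^(-8/3). The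
  constants are rounded up to the one in \<open>delta_bounds\<close>.\<close>

lemma delta_hat_bounds:
  fixes P \<Gamma> L :: "real mat" and h \<kappa> \<rho> :: real
  defines "a \<equiv> spectral_norm P * spectral_norm (minv P)" and "g \<equiv> 1 - spectral_norm \<Gamma>"
    and "l \<equiv> spectral_norm (minv L)"
  assumes a: "1 \<le> a" "a \<le> \<kappa>" and g: "(1 - \<rho>) / 2 \<le> g" "g \<le> 1 - \<rho>"
    and l: "h / (1 - \<rho>) \<le> l" "l \<le> 1 / (1 - \<rho>)" and h: "0 < h" "h \<le> 1"
    and \<rho>: "0 \<le> \<rho>" "\<rho> < 1"
  shows "delta_hat Var_x P \<Gamma> L \<le> 4 * \<kappa> ^ 4 * (1 - \<rho>) powr (- 2)"
    and "s \<noteq> Var_x \<Longrightarrow> delta_hat s P \<Gamma> L \<le> 4 * \<kappa> ^ 4 * (1 - \<rho>) powr (- 8 / 3)"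
    and "s \<noteq> Var_x \<Longrightarrow> h\<^sup>2 * (1 - \<rho>) powr (- 8 / 3) \<le> delta_hat s P \<Gamma> L"
proof -
  define D where "D = 1 - \<rho>"
  have D: "0 < D" "0 < g" using \<rho> g by (auto simp: D_def)
  have \<kappa>: "1 \<le> \<kappa>" using a by simp
  then have \<kappa>2: "1 \<le> 2 * \<kappa>\<^sup>2" using one_le_power[of \<kappa> 2] by linarith
  have l0: "0 \<le> l" by (simp add: l_def)
  have \<kappa>24: "\<kappa>\<^sup>2 \<le> \<kappa> ^ 4" "\<kappa> \<le> \<kappa> ^ 4"
    using \<kappa> power_increasing[of 2 4 \<kappa>] power_increasing[of 1 4 \<kappa>] by auto
  have inv: "1 / D ^ m = D powr (- real m)" for m
    using D by (simp add: powr_minus_divide powr_realpow)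
  have yz: "delta_hat s P \<Gamma> L = (a * l / g) powr (4 / 3)" if "s \<noteq> Var_x" for s
    using that by (cases s) (simp_all add: a_def g_def l_def)
  have ub: "a * l / g \<le> 2 * \<kappa> * D powr (- 2)"
  proof -
    have "a * l / g \<le> \<kappa> * (1 / D) / (D / 2)"
      using a l l0 g D by (intro frac_le mult_mono) (auto simp: D_def)
    also have "\<dots> = 2 * \<kappa> * (1 / D ^ 2)" by (simp add: power2_eq_square)
    finally show ?thesis by (simp only: inv) simp
  qed
  have nn: "0 \<le> a * l / g" using a l0 D by simp
  have "(spectral_norm P)\<^sup>2 * (spectral_norm (minv P))\<^sup>2 * l\<^sup>2 / g = a\<^sup>2 * l\<^sup>2 / g"
    by (simp add: a_def power_mult_distrib)
  then have x: "delta_hat Var_x P \<Gamma> L = (a\<^sup>2 * l\<^sup>2 / g) powr (2 / 3) + a * l / g"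
    by (simp only: delta_hat.simps a_def g_def l_def)
  have "a\<^sup>2 * l\<^sup>2 / g \<le> \<kappa>\<^sup>2 * (1 / D)\<^sup>2 / (D / 2)"
    using a l l0 g D by (intro frac_le mult_mono power_mono) (auto simp: D_def)
  also have "\<dots> = 2 * \<kappa>\<^sup>2 * (1 / D ^ 3)" by (simp add: power2_eq_square power3_eq_cube)
  also have "\<dots> = 2 * \<kappa>\<^sup>2 * D powr (- 3)" by (simp only: inv) simp
  finally have "(a\<^sup>2 * l\<^sup>2 / g) powr (2 / 3) \<le> (2 * \<kappa>\<^sup>2 * D powr (- 3)) powr (2 / 3)"
    using D by (intro powr_mono2) auto
  also have "\<dots> = (2 * \<kappa>\<^sup>2) powr (2 / 3) * D powr (- 2)"
    by (simp add: powr_mult powr_powr)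
  \<comment> \<open>The base is at least 1, so raising the exponent from 2/3 to 1 only enlarges the
    constant and makes it polynomial in \<kappa>.\<close>
  also have "\<dots> \<le> (2 * \<kappa>\<^sup>2) powr 1 * D powr (- 2)"
    using \<kappa>2 by (intro mult_right_mono powr_mono) auto
  also have "\<dots> = 2 * \<kappa>\<^sup>2 * D powr (- 2)" using \<kappa> by simp
  finally have "delta_hat Var_x P \<Gamma> L \<le> (2 * \<kappa>\<^sup>2 + 2 * \<kappa>) * D powr (- 2)"
    using ub unfolding x by (simp add: distrib_right)
  also have "\<dots> \<le> 4 * \<kappa> ^ 4 * D powr (- 2)"
    using \<kappa>24 by (intro mult_right_mono) auto
  finally show "delta_hat Var_x P \<Gamma> L \<le> 4 * \<kappa> ^ 4 * (1 - \<rho>) powr (- 2)" by (simp add: D_def)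
  show "delta_hat s P \<Gamma> L \<le> 4 * \<kappa> ^ 4 * (1 - \<rho>) powr (- 8 / 3)" if s: "s \<noteq> Var_x"
  proof -
    have "delta_hat s P \<Gamma> L \<le> (2 * \<kappa> * D powr (- 2)) powr (4 / 3)"
      unfolding yz[OF s] using ub nn by (intro powr_mono2) auto
    also have "\<dots> = (2 * \<kappa>) powr (4 / 3) * D powr (- 8 / 3)"
      using \<kappa> by (simp add: powr_mult powr_powr)
    also have "\<dots> \<le> (2 * \<kappa>) powr 2 * D powr (- 8 / 3)"
      using \<kappa> by (intro mult_right_mono powr_mono) auto
    also have "(2 * \<kappa>) powr 2 = 4 * \<kappa>\<^sup>2"
      using \<kappa> by (simp add: powr_numeral power_mult_distrib)
    also have "4 * \<kappa>\<^sup>2 * D powr (- 8 / 3) \<le> 4 * \<kappa> ^ 4 * D powr (- 8 / 3)"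
      using \<kappa>24 by (intro mult_right_mono) auto
    finally show ?thesis by (simp add: D_def)
  qed
  show "h\<^sup>2 * (1 - \<rho>) powr (- 8 / 3) \<le> delta_hat s P \<Gamma> L" if s: "s \<noteq> Var_x"
  proof -
    have "h\<^sup>2 * D powr (- 8 / 3) = h powr 2 * D powr (- 8 / 3)"
      using h by (simp add: powr_numeral)
    \<comment> \<open>Here the base is at most 1, so lowering the exponent enlarges the
      power.\<close>
    also have "\<dots> \<le> h powr (4 / 3) * D powr (- 8 / 3)"
      using h by (intro mult_right_mono powr_mono') auto
    also have "\<dots> = (h * D powr (- 2)) powr (4 / 3)"
      using h by (simp add: powr_mult powr_powr)
    also have "\<dots> \<le> (a * l / g) powr (4 / 3)"
    proof (intro powr_mono2)
      have "h * D powr (- 2) = 1 * (h / D) / D"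
        using inv[of 2] by (simp add: power2_eq_square) (metis times_divide_eq_right mult.right_neutral)
      also have "\<dots> \<le> a * l / g"
        using a l l0 h D g by (intro frac_le mult_mono) (auto simp: D_def)
      finally show "h * D powr (- 2) \<le> a * l / g" .
    qed (use h in auto)
    finally show ?thesis by (simp add: D_def yz[OF s])
  qed
qed

subsection \<open>Transient complexity\<close>

text \<open>As n \<ge> 1, every term of order D^-2 carries a power of n that n^3 absorbs. Only the
  two hatted quantities of y and z bring in the exponent 8/3, and they carry the factor n.\<close>

lemma transient_complexity_le:
  fixes n :: nat and B D :: real
  assumes n: "1 \<le> n" and B: "0 \<le> B" and D: "0 < D"
    and "\<And>s. \<delta> s \<le> B * D powr (- 2)"
    and "\<delta>h Var_x \<le> B * D powr (- 2)"
    and "\<And>s. s \<noteq> Var_x \<Longrightarrow> \<delta>h s \<le> B * D powr (- 8 / 3)"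
  shows "transient_complexity n \<delta> \<delta>h \<le> B * max (real n ^ 3 / D\<^sup>2) (real n / D powr (8 / 3))"
proof -
  define R where "R = max (real n ^ 3 / D\<^sup>2) (real n / D powr (8 / 3))"
  have R: "real n ^ 3 * D powr (- 2) \<le> R" "real n * D powr (- 8 / 3) \<le> R"
    unfolding R_def over_powr(1)[OF D, symmetric] over_powr(2)[symmetric]
    by (rule max.cobounded1 max.cobounded2)+
  have scaled: "real n ^ m * u \<le> B * R"
    if "u \<le> B * D powr t" "real n ^ m * D powr t \<le> R" for u t m
  proof -
    have "real n ^ m * u \<le> real n ^ m * (B * D powr t)"
      using that by (intro mult_left_mono) auto
    also have "\<dots> = B * (real n ^ m * D powr t)" by simp
    also have "\<dots> \<le> B * R" using that B by (intro mult_left_mono)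
    finally show ?thesis .
  qed
  have "real n ^ m * D powr (- 2) \<le> R" if "m \<le> 3" for m
    using n power_increasing[OF that, of "real n"] by (intro order_trans[OF mult_right_mono R(1)]) auto
  from this[of 2] this[of 3] this[of 1] have "real n ^ 2 * \<delta> Var_x \<le> B * R" "real n ^ 3 * \<delta> Var_y \<le> B * R"
    "real n ^ 3 * \<delta> Var_z \<le> B * R" "real n ^ 1 * \<delta>h Var_x \<le> B * R"
    "real n ^ 1 * \<delta>h Var_y \<le> B * R" "real n ^ 1 * \<delta>h Var_z \<le> B * R"
    using R(2) by (auto intro!: scaled[OF assms(4)] scaled[OF assms(5), where m = 1, simplified]
        scaled[OF assms(6), where m = 1, simplified])
  then show ?thesis by (simp add: transient_complexity_def flip: R_def)
qed

text \<open>The two terms of the maximum that belong to y already reproduce both competing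
  rates.\<close>

lemma le_transient_complexity:
  fixes n :: nat and b b' D :: real
  assumes b: "0 < b" "0 < b'" and D: "0 < D"
    and \<delta>: "b * D powr (- 2) \<le> \<delta> Var_y" and \<delta>h: "b' * D powr (- 8 / 3) \<le> \<delta>h Var_y"
  shows "max (real n ^ 3 / D\<^sup>2) (real n / D powr (8 / 3)) \<le>
    max (1 / b) (1 / b') * transient_complexity n \<delta> \<delta>h"
proof -
  define T where "T = transient_complexity n \<delta> \<delta>h"
  have T: "real n ^ 3 * \<delta> Var_y \<le> T" "real n * \<delta>h Var_y \<le> T"
    unfolding T_def transient_complexity_def by (rule Max_ge; simp)+
  have "0 \<le> \<delta>h Var_y" using \<delta>h b by (smt (verit) mult_nonneg_nonneg powr_ge_zero)
  \<comment> \<open>Nonnegativity of T permits replacing 1/b and 1/b' by their maximum.\<close>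
  then have T0: "0 \<le> T" using T(2) by (smt (verit) mult_nonneg_nonneg of_nat_0_le_iff)
  have "b * (real n ^ 3 / D\<^sup>2) = real n ^ 3 * (b * D powr (- 2))"
    by (simp add: over_powr(1)[OF D])
  also have "\<dots> \<le> T" using T(1) mult_left_mono[OF \<delta>, of "real n ^ 3"] by simp
  finally have 1: "real n ^ 3 / D\<^sup>2 \<le> 1 / b * T" using b by (simp add: field_simps)
  have "b' * (real n / D powr (8 / 3)) = real n * (b' * D powr (- 8 / 3))"
    by (simp add: over_powr(2))
  also have "\<dots> \<le> T" using T(2) mult_left_mono[OF \<delta>h, of "real n"] by simp
  finally have 2: "real n / D powr (8 / 3) \<le> 1 / b' * T"
    using b(2) by (simp add: pos_le_divide_eq mult.commute)
  show ?thesis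
    unfolding T_def[symmetric]
    using order_trans[OF 1 mult_right_mono[OF max.cobounded1 T0]]
      order_trans[OF 2 mult_right_mono[OF max.cobounded2 T0]] by (rule max.boundedI)
qed

text \<open>\<open>K\<close> and \<open>K'\<close> are chosen before the number of agents, the
  dimensions, the variant and the network, so they are uniform on the class given by c. The reverse
  comparison depends on a lower bound r for \<rho>: at \<rho> = 0 the ATC and semi-ATC variants have
  \<open>La\<close> = 0, so \<delta> vanishes for y and z while the rate still contains n^3.\<close>

theorem corollary3:
  fixes c :: real
  assumes "0 < c"
  shows "\<exists>K > 0. \<exists>K' :: real \<Rightarrow> real.
    \<forall>(n::nat) (p::nat) (q::nat) (v::gt_variant) (W :: variable \<Rightarrow> real mat) (U :: variable \<Rightarrow> real mat)
      (La :: variable \<Rightarrow> real mat) (Lb :: variable \<Rightarrow> real mat) (Lc :: variable \<Rightarrow> real mat).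
      2 \<le> n \<and> 1 \<le> p \<and> 1 \<le> q \<and>
      (\<forall>s. mixing_matrix n (W s) \<and> c \<le> 1 + lambda_min (W s)) \<and>
      W Var_y = W Var_z \<and>
      (\<forall>s. eigenbasis n (W s) (U s) \<and>
           spectral_data n (U s) (mat_A v (W s)) (mat_B (W s)) (mat_C (W s)) (La s) (Lb s) (Lc s))
      \<longrightarrow>
      (let d = var_dim p q;
           M = (\<lambda>s. iteration_matrix (bold (d s) (Lb s)) (bold (d s) (Lc s)))
       in \<exists>(P :: variable \<Rightarrow> real mat) (\<Gamma> :: variable \<Rightarrow> real mat).
         (\<forall>s. factorization (M s) (P s) (\<Gamma> s)) \<and>
         (\<forall>s t. M s = M t \<longrightarrow> P s = P t \<and> \<Gamma> s = \<Gamma> t) \<and>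
         (let \<delta> = (\<lambda>s. delta s (P s) (\<Gamma> s) (bold (d s) (La s)));
              \<delta>h = (\<lambda>s. delta_hat s (P s) (\<Gamma> s) (bold (d s) (Lb s)));
              \<rho>x = mixing_rate (W Var_x);
              \<rho>y = mixing_rate (W Var_y)
          in \<delta> Var_x \<le> K * (1 - \<rho>x) powr (-2) \<and>
             \<delta> Var_y = \<delta> Var_z \<and> \<delta> Var_y \<le> K * (1 - \<rho>y) powr (-2) \<and>
             \<delta>h Var_x \<le> K * (1 - \<rho>x) powr (-2) \<and>
             \<delta>h Var_y = \<delta>h Var_z \<and> \<delta>h Var_y \<le> K * (1 - \<rho>y) powr (-8/3) \<and>
             (W Var_x = W Var_y \<longrightarrow>
               (let \<rho> = \<rho>x;
                    T = transient_complexity n \<delta> \<delta>h;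
                    R = max (real n ^ 3 / (1 - \<rho>)\<^sup>2) (real n / (1 - \<rho>) powr (8/3))
                in T \<le> K * R \<and> (\<forall>r > 0. r \<le> \<rho> \<longrightarrow> R \<le> K' r * T)))))"
proof -
  \<comment> \<open>The coupling estimate requires c \<le> 1, hence the truncation. \<kappa> bounds
    the condition number, h is the constant in the lower bound for the inverse of the bold
    \<open>Lb\<close>, and \<open>K'\<close> inverts the lower constants r^4 and h^2 of the two
    quantities for y.\<close>
  define c' where "c' = min c 1"
  define \<kappa> where "\<kappa> = 16 / c'"
  define K where "K = 4 * \<kappa> ^ 4"
  define h where "h = c' / 2"
  define K' where "K' = (\<lambda>r :: real. max (1 / r ^ 4) (1 / h\<^sup>2))"
  have c': "0 < c'" "c' \<le> 1" "c' \<le> c" using assms by (auto simp: c'_def)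
  then have h: "0 < h" "h \<le> 1" and K: "0 < K" by (auto simp: h_def K_def \<kappa>_def)
  show ?thesis
  proof (intro exI[of _ K] exI[of _ K'] conjI[OF K] allI impI, elim conjE, goal_cases)
    case (1 n p q v W U La Lb Lc)
    note n = 1(1) and pq = 1(2,3) and mm = 1(4) and Wyz = 1(5) and sd = 1(6)
    define d where "d = var_dim p q"
    define M where "M = (\<lambda>s. iteration_matrix (bold (d s) (Lb s)) (bold (d s) (Lc s)))"
    define P where "P = (\<lambda>s. jordan_basis (dim_row (M s) div 2) (c' / 8))"
    define \<Gamma> where "\<Gamma> = (\<lambda>s. minv (P s) * M s * P s)"
    define \<delta> where "\<delta> = (\<lambda>s. delta s (P s) (\<Gamma> s) (bold (d s) (La s)))"
    define \<delta>h where "\<delta>h = (\<lambda>s. delta_hat s (P s) (\<Gamma> s) (bold (d s) (Lb s)))"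
    define \<rho> where "\<rho> = (\<lambda>s. mixing_rate (W s))"
    have rate: "\<rho> s < 1" for s using mm by (auto simp: mixing_matrix_def \<rho>_def)
    have d1: "1 \<le> d s" for s using pq by (cases s) (auto simp: d_def)
    have c'_le: "c' \<le> 1 + lambda_min (W s)" for s using mm c'(3) order_trans by blast
    have nb': "factorization (M s) (P s) (\<Gamma> s)"
      "1 \<le> spectral_norm (P s) * spectral_norm (minv (P s))"
      "spectral_norm (P s) * spectral_norm (minv (P s)) \<le> \<kappa>"
      "(1 - \<rho> s) / 2 \<le> 1 - spectral_norm (\<Gamma> s)"
      "1 - spectral_norm (\<Gamma> s) \<le> 1 - \<rho> s"
      "(\<rho> s)\<^sup>2 \<le> spectral_norm (bold (d s) (La s))"
      "spectral_norm (bold (d s) (La s)) \<le> 1"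
      "h / (1 - \<rho> s) \<le> spectral_norm (minv (bold (d s) (Lb s)))"
      "spectral_norm (minv (bold (d s) (Lb s))) \<le> 1 / (1 - \<rho> s)"
      "0 \<le> \<rho> s" for s
      unfolding M_def P_def \<Gamma>_def \<rho>_def \<kappa>_def h_def
      by (rule sparkle_norm_bounds[OF c'(1,2) c'_le[of s] n d1[of s] conjunct1[OF spec[OF sd, of s]]
        rate[of s, unfolded \<rho>_def] conjunct2[OF spec[OF sd, of s]]])+
    have \<delta>: "\<delta> s \<le> K * (1 - \<rho> s) powr (- 2)"
      "s \<noteq> Var_x \<Longrightarrow> \<rho> s ^ 4 * (1 - \<rho> s) powr (- 2) \<le> \<delta> s" for s
      unfolding \<delta>_def K_def
      by (rule delta_bounds[OF nb'(2-7,10) rate] | assumption)+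
    have \<delta>h: "\<delta>h Var_x \<le> K * (1 - \<rho> Var_x) powr (- 2)"
      unfolding \<delta>h_def K_def
      by (rule delta_hat_bounds(1)[OF nb'(2-5,8,9) h nb'(10) rate])
    have \<delta>hy: "s \<noteq> Var_x \<Longrightarrow> \<delta>h s \<le> K * (1 - \<rho> s) powr (- 8 / 3)"
      "s \<noteq> Var_x \<Longrightarrow> h\<^sup>2 * (1 - \<rho> s) powr (- 8 / 3) \<le> \<delta>h s" for s
      unfolding \<delta>h_def K_def
      by (rule delta_hat_bounds(2,3)[OF nb'(2-5,8,9) h nb'(10) rate] | assumption)+
    \<comment> \<open>\<open>U Var_y\<close> and \<open>U Var_z\<close> may be different eigenbases
      of the same matrix; the diagonal data agree nevertheless, because they depend only on W and
      the variant. Since y and z also share the dimension q, all derived quantities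
      coincide.\<close>
    have L: "La Var_y = La Var_z" "Lb Var_y = Lb Var_z" "Lc Var_y = Lc Var_z"
      using spectral_data_unique[OF n conjunct1[OF spec[OF sd]] rate[unfolded \<rho>_def] conjunct2[OF spec[OF sd]]] Wyz
      by metis+
    then have eq: "\<delta> Var_y = \<delta> Var_z" "\<delta>h Var_y = \<delta>h Var_z"
      by (simp_all add: \<delta>_def \<delta>h_def \<Gamma>_def P_def M_def d_def)
    have T: "transient_complexity n \<delta> \<delta>h \<le>
        K * max (real n ^ 3 / (1 - \<rho> Var_x)\<^sup>2) (real n / (1 - \<rho> Var_x) powr (8 / 3))"
      "\<And>r. 0 < r \<Longrightarrow> r \<le> \<rho> Var_x \<Longrightarrow>
        max (real n ^ 3 / (1 - \<rho> Var_x)\<^sup>2) (real n / (1 - \<rho> Var_x) powr (8 / 3))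
          \<le> K' r * transient_complexity n \<delta> \<delta>h"
      if "W Var_x = W Var_y"
    proof -
      \<comment> \<open>Equal mixing matrices do not make the bold data of x and y equal, as p and q
        may differ; only the common rate enters the comparison.\<close>
      have \<rho>: "\<rho> s = \<rho> Var_x" for s using that Wyz by (cases s) (simp_all add: \<rho>_def)
      show "transient_complexity n \<delta> \<delta>h \<le>
          K * max (real n ^ 3 / (1 - \<rho> Var_x)\<^sup>2) (real n / (1 - \<rho> Var_x) powr (8 / 3))"
      proof (intro transient_complexity_le)
        show "\<delta> s \<le> K * (1 - \<rho> Var_x) powr (- 2)" for s
          using \<delta>(1)[of s] by (simp add: \<rho>[of s])
        show "\<delta>h s \<le> K * (1 - \<rho> Var_x) powr (- 8 / 3)" if "s \<noteq> Var_x" for s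
          using \<delta>hy(1)[OF that] by (simp add: \<rho>[of s])
      qed (use n K rate[of Var_x] \<delta>h in auto)
      fix r assume r: "0 < r" "r \<le> \<rho> Var_x"
      have "r ^ 4 * (1 - \<rho> Var_x) powr (- 2) \<le> \<rho> Var_x ^ 4 * (1 - \<rho> Var_x) powr (- 2)"
        using r by (intro mult_right_mono power_mono) auto
      also have "\<dots> \<le> \<delta> Var_y" using \<delta>(2)[of Var_y] unfolding \<rho>[of Var_y] by simp
      finally show "max (real n ^ 3 / (1 - \<rho> Var_x)\<^sup>2) (real n / (1 - \<rho> Var_x) powr (8 / 3))
          \<le> K' r * transient_complexity n \<delta> \<delta>h"
        unfolding K'_def using r h rate[of Var_x] \<delta>hy(2)[of Var_y] unfolding \<rho>[of Var_y]
        by (intro le_transient_complexity) auto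
    qed
    have same: "\<forall>s t. M s = M t \<longrightarrow> P s = P t \<and> \<Gamma> s = \<Gamma> t"
      by (simp add: \<Gamma>_def P_def)
    have concl: "\<delta> Var_x \<le> K * (1 - \<rho> Var_x) powr (- 2) \<and>
      \<delta> Var_y = \<delta> Var_z \<and> \<delta> Var_y \<le> K * (1 - \<rho> Var_y) powr (- 2) \<and>
      \<delta>h Var_x \<le> K * (1 - \<rho> Var_x) powr (- 2) \<and>
      \<delta>h Var_y = \<delta>h Var_z \<and> \<delta>h Var_y \<le> K * (1 - \<rho> Var_y) powr (- 8 / 3) \<and>
      (W Var_x = W Var_y \<longrightarrow>
        transient_complexity n \<delta> \<delta>h \<le>
          K * max (real n ^ 3 / (1 - \<rho> Var_x)\<^sup>2) (real n / (1 - \<rho> Var_x) powr (8 / 3)) \<and>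
        (\<forall>r > 0. r \<le> \<rho> Var_x \<longrightarrow>
          max (real n ^ 3 / (1 - \<rho> Var_x)\<^sup>2) (real n / (1 - \<rho> Var_x) powr (8 / 3))
            \<le> K' r * transient_complexity n \<delta> \<delta>h))"
      by (intro conjI allI impI eq \<delta>(1) \<delta>h \<delta>hy(1) T) auto
    show ?case
      unfolding Let_def
      by (rule exI[of _ P], rule exI[of _ \<Gamma>],
          rule conjI[OF allI[OF nb'(1)] conjI[OF same concl],
            unfolded M_def \<delta>_def \<delta>h_def \<rho>_def d_def])
  qed
qed

end
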